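(* Fix $K\ge 1$ and weights $\pi_1,\dots,\pi_K>0$ with $\sum_{i=1}^K\pi_i=1$. For each dimension $m$ let $\bm\xi$ be a random vector in $\mathbb{R}^m$ with Gaussian mixture density $p^*(\bm z)=\sum_{i=1}^K\pi_i p(\bm z|\bm\mu_i,\Sigma_i)$, and let $c(\bm\xi)=\frac12\bm\xi^\top A\bm\xi+\bm a^\top\bm\xi+a$ with $A\in\mathbb{R}^{m\times m}$ symmetric, $\bm a\in\mathbb{R}^m$, $a\in\mathbb{R}$ (here $\bm\mu_i,\Sigma_i,A,\bm a,a$ may depend on $m$). Let $h_i$, $\lambda_{ij}$, $\delta_{ij}$ be the quantities defined in the context, and suppose $h_i\to+\infty$ as $m\to+\infty$ for $i=1,\dots,K$. If $$\lim_{m\to+\infty}\frac{\left(\sum_{j=1}^{h_i}\left(\frac1k+\delta_{ij}^2\right)\lambda_{ij}^k\right)^{\frac1k}}{\left(\sum_{j=1}^{h_i}\left(\frac12+\delta_{ij}^2\right)\lambda_{ij}^2\right)^{\frac12}}=0$$ holds uniformly over all integers $k\ge 3$, for $i=1,\dots,K$, then for every $t\in\mathbb{R}$ $$\lim_{m\to+\infty}\left(E_{p^*}\left(e^{\mathrm{i}t\frac{c(\bm\xi)}{\sigma}}\right)-\sum_{i=1}^K\pi_i e^{\mathrm{i}\frac{\mu_i}{\sigma}t-\frac12\frac{\sigma_i^2}{\sigma^2}t^2}\right)=0,$$ where $\mu_i=E_{p_i}(c(\bm\xi))$, $\sigma_i^2=V_{p_i}(c(\bm\xi))$, $\sigma^2=V_{p^*}(c(\bm\xi))$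 and $\sigma=\sqrt{\sigma^2}$.
   Context: $p_i=p(\cdot|\bm\mu_i,\Sigma_i)$ is the Gaussian density on $\mathbb{R}^m$ with mean $\bm\mu_i$ and covariance matrix $\Sigma_i$; each $\Sigma_i$ is assumed non-singular (positive definite). $E_p$ and $V_p$ denote mean and variance when $\bm\xi$ has density $p$, and $\mathrm{i}$ in an exponent is the imaginary unit. For each $m$ and $i$: $\Sigma_i^{1/2}$ is the symmetric positive definite square root of $\Sigma_i$. Write $\Sigma_i^{1/2}A\Sigma_i^{1/2}=D_i\Lambda_iD_i^\top$ with $D_i$ orthogonal and $\Lambda_i=\mathrm{diag}(\lambda_{i1},\dots,\lambda_{im})$, ordered so that exactly the first $h_i$ diagonal entries are nonzero, $0<h_i\le m$. Let $b_{ij}$ be the $j$th entry of $\bm b_i=D_i^\top\Sigma_i^{1/2}\bm a$ and $d_{ij}$ the $j$th entry of $D_i^\top\Sigma_i^{-1/2}\bm\mu_i$. Define $\delta_{ij}=d_{ij}+\frac{b_{ij}}{\lambda_{ij}}$ for $j=1,\dots,h_i$. All these quantities depend on $m$. The power $(\cdot)^{1/k}$ is the real $k$th root (for odd $k$ the argument may be negative). *)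

theory Defs
  imports "HOL-Probability.Probability"
    "Jordan_Normal_Form.Gauss_Jordan_Elimination"
    "Jordan_Normal_Form.Determinant"
begin

text \<open>The dimension varies, so \<open>\<real>\<^sup>m\<close> is rendered as \<^term>\<open>carrier_vec m :: real vec set\<close>
  and matrices are those of the carrier-based matrix library. Coordinates are counted from \<open>0\<close>.\<close>

no_notation vec_nth (infixl "$" 90)
unbundle no inner_syntax

definition pos_def_mat :: "nat \<Rightarrow> real mat \<Rightarrow> bool" where
  "pos_def_mat m S \<longleftrightarrow> S \<in> carrier_mat m m \<and> transpose_mat S = S \<and>
     (\<forall>v \<in> carrier_vec m. v \<noteq> 0\<^sub>v m \<longrightarrow> 0 < v \<bullet> (S *\<^sub>v v))"

text \<open>The predicate \<^const>\<open>orthogonal_mat\<close> of the library does not require the columns to have norm 1.\<close>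

definition orthonormal_mat :: "nat \<Rightarrow> real mat \<Rightarrow> bool" where
  "orthonormal_mat m D \<longleftrightarrow> D \<in> carrier_mat m m \<and>
     transpose_mat D * D = 1\<^sub>m m \<and> D * transpose_mat D = 1\<^sub>m m"

text \<open>Only meaningful on non-singular matrices.\<close>

definition inv_mat :: "real mat \<Rightarrow> real mat" where
  "inv_mat S = the (mat_inverse S)"

text \<open>Lebesgue measure on \<^term>\<open>carrier_vec m\<close>, carried over from the \<open>m\<close>-fold product of
  \<^term>\<open>lborel\<close>, on which \<^term>\<open>Matrix.vec m\<close> is injective.\<close>

definition lborel_vec :: "nat \<Rightarrow> real vec measure" where
  "lborel_vec m = embed_measure (\<Pi>\<^sub>M i\<in>{..<m}. lborel) (Matrix.vec m)"

lemma inj_on_vec_PiM: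
  "inj_on (Matrix.vec m) (space (\<Pi>\<^sub>M i\<in>{..<m}. (lborel :: real measure)))"
  by (rule inj_onI, rule ext)
    (metis PiE_E dim_vec index_vec lessThan_iff space_PiM)

definition gauss_density :: "nat \<Rightarrow> real vec \<Rightarrow> real mat \<Rightarrow> real vec \<Rightarrow> real" where
  "gauss_density m \<mu> S z =
     exp (- (1/2) * ((z - \<mu>) \<bullet> (inv_mat S *\<^sub>v (z - \<mu>)))) /
     sqrt ((2 * pi) ^ m * Determinant.det S)"

definition mixture_density ::
  "nat \<Rightarrow> nat \<Rightarrow> (nat \<Rightarrow> real) \<Rightarrow> (nat \<Rightarrow> real vec) \<Rightarrow> (nat \<Rightarrow> real mat) \<Rightarrow> real vec \<Rightarrow> real" where
  "mixture_density m K w \<mu> S z = (\<Sum>i=1..K. w i * gauss_density m (\<mu> i) (S i) z)"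

text \<open>Mean and variance of \<open>f(\<xi>)\<close> for a random vector \<open>\<xi>\<close> in \<open>\<real>\<^sup>m\<close> with density \<open>p\<close>.\<close>

definition law :: "nat \<Rightarrow> (real vec \<Rightarrow> real) \<Rightarrow> real vec measure" where
  "law m p = density (lborel_vec m) (\<lambda>z. ennreal (p z))"

definition mean_under ::
  "nat \<Rightarrow> (real vec \<Rightarrow> real) \<Rightarrow> (real vec \<Rightarrow> 'b::{banach, second_countable_topology}) \<Rightarrow> 'b" where
  "mean_under m p f = (\<integral>z. f z \<partial>law m p)"

definition var_under :: "nat \<Rightarrow> (real vec \<Rightarrow> real) \<Rightarrow> (real vec \<Rightarrow> real) \<Rightarrow> real" where
  "var_under m p f = mean_under m p (\<lambda>z. (f z - mean_under m p f)\<^sup>2)"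

definition quad :: "real mat \<Rightarrow> real vec \<Rightarrow> real \<Rightarrow> real vec \<Rightarrow> real" where
  "quad A a a0 z = 1/2 * (z \<bullet> (A *\<^sub>v z)) + a \<bullet> z + a0"

text \<open>Here \<open>R\<close> stands for \<open>\<Sigma>\<^sub>i\<^sup>1\<^sup>/\<^sup>2\<close>; the two summands are
  \<open>d\<^sub>i\<^sub>j\<close> and \<open>b\<^sub>i\<^sub>j / \<lambda>\<^sub>i\<^sub>j\<close>.\<close>

definition shift_coeff ::
  "real mat \<Rightarrow> real mat \<Rightarrow> (nat \<Rightarrow> real) \<Rightarrow> real vec \<Rightarrow> real vec \<Rightarrow> nat \<Rightarrow> real" where
  "shift_coeff R D l \<mu> a j =
     (transpose_mat D *\<^sub>v (inv_mat R *\<^sub>v \<mu>)) $ j + (transpose_mat D *\<^sub>v (R *\<^sub>v a)) $ j / l j"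

end

theory Submission
  imports Defs "HOL-Real_Asymp.Real_Asymp"
begin

text \<open>Under the component \<open>p\<^sub>i\<close>, write \<open>\<xi> = R D (d + y)\<close> with \<open>y\<close> standard normal. Then \<open>c(\<xi>)\<close> is its mean
  plus a sum of independent variables \<open>l\<^sub>j (y\<^sub>j\<^sup>2 - 1) / 2 + \<beta>\<^sub>j y\<^sub>j\<close> of variance
  \<open>q\<^sub>j = l\<^sub>j\<^sup>2 / 2 + \<beta>\<^sub>j\<^sup>2\<close>, where \<open>\<beta>\<^sub>j = l\<^sub>j \<delta>\<^sub>j\<close> if \<open>l\<^sub>j \<noteq> 0\<close>.
  The characteristic function of one summand satisfies a linear differential equation
  \<open>\<phi>' = \<phi> (- u q + r)\<close> with \<open>\<bar>r\<bar> \<le> 3/2 u\<^sup>2 \<bar>l\<bar> q\<close>, hence differs from \<open>exp (- u\<^sup>2 q / 2)\<close> by at most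
  \<open>3/2 \<bar>u\<bar>\<^sup>3 \<bar>l\<bar> q\<close>. These errors add up over the coordinates. At \<open>u = t / \<sigma>\<close>, since
  \<open>\<sigma>\<^sup>2 \<ge> w\<^sub>i \<sigma>\<^sub>i\<^sup>2\<close>, Cauchy--Schwarz bounds the total by a constant times the square of the ratio in
  the hypothesis for \<open>k = 4\<close>.\<close>

section \<open>A quadratic polynomial of a standard normal variable\<close>

text \<open>Exponent 4 is used because the error of a summand is cubic in its coefficients: the sums
  for \<open>k = 3\<close> carry signs and may cancel, while for \<open>k = 4\<close> every term is
  nonnegative. The cubic sum is interpolated between the quadratic sum S2 and the quartic sum S4, up
  to a constant by S2^(1/2) S4^(1/2). Since \<sigma>^3 is at least a multiple of S2^(3/2), the
  quotient is of order S4^(1/2) / S2, the square of the ratio in the hypothesis. The characteristic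
  function of one summand has a closed form, but with a complex square root of 1 - i u l. Its
  logarithmic derivative is rational, so the differential equation avoids choosing a branch or
  expanding a logarithm; the Gaussian is its solution for r = 0. The diagonalising basis depends on
  the component. Each component is therefore treated in its own coordinates, and only the common
  scale \<sigma> links them; the spread of the component means can only enlarge \<sigma>.\<close>

lemma stein_identity_std_normal:
  fixes f f' :: "real \<Rightarrow> complex"
  assumes deriv: "\<And>x. (f has_vector_derivative f' x) (at x)"
    and cont: "continuous_on UNIV f'"
    and int_f: "integrable std_normal_distribution (\<lambda>x. x * f x)"
    and int_f': "integrable std_normal_distribution f'"
    and at_top: "((\<lambda>x. std_normal_density x * cmod (f x)) \<longlongrightarrow> 0) at_top"
    and at_bot: "((\<lambda>x. std_normal_density x * cmod (f x)) \<longlongrightarrow> 0) at_bot"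
  shows "(\<integral>x. x * f x \<partial>std_normal_distribution) = (\<integral>x. f' x \<partial>std_normal_distribution)"
proof -
  have cont_f: "continuous_on UNIV f"
    using deriv by (intro continuous_at_imp_continuous_on) (auto intro: has_vector_derivative_continuous)
  note [measurable] = borel_measurable_continuous_onI[OF cont_f] borel_measurable_continuous_onI[OF cont]
  \<comment> \<open>The density has derivative \<open>- x\<close> times itself, so \<open>F'\<close>
    is the derivative of \<open>F\<close>, and its integral over the line is the difference of the
    two sides of the claim.\<close>
  define F where "F x = std_normal_density x *\<^sub>R f x" for x
  define F' where "F' x = std_normal_density x *\<^sub>R f' x - std_normal_density x *\<^sub>R (x * f x)" for x
  have dens: "(std_normal_density has_real_derivative - x * std_normal_density x) (at x)" for x
  proof -
    define k where "k = 1 / sqrt (2 * pi)"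
    show ?thesis
      unfolding std_normal_density_def k_def[symmetric] by (auto intro!: derivative_eq_intros)
  qed
  have dF: "(F has_vector_derivative F' x) (at x)" for x
    unfolding F_def F'_def
    by (rule has_vector_derivative_eq_rhs[OF has_vector_derivative_scaleR[OF dens deriv]])
       (simp add: scaleR_conv_of_real)
  have i1: "integrable lborel (\<lambda>x. std_normal_density x *\<^sub>R f' x)"
    using int_f' by (subst (asm) integrable_density) auto
  have i2: "integrable lborel (\<lambda>x. std_normal_density x *\<^sub>R (x * f x))"
    using int_f by (subst (asm) integrable_density) auto
  have contF: "isCont F' x" for x
    using cont cont_f unfolding F'_def std_normal_density_def
    by (auto intro!: continuous_intros simp: continuous_on_eq_continuous_at)
  have nF: "norm (F x) = std_normal_density x * cmod (f x)" for x
    by (simp add: F_def)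
  have "(LBINT x=-\<infinity>..\<infinity>. F' x) = 0 - 0"
  proof (rule interval_integral_FTC_integrable)
    show "set_integrable lborel (einterval (-\<infinity>) \<infinity>) F'"
      using i1 i2 unfolding set_integrable_def F'_def by (simp add: einterval_def)
    show "((F \<circ> real_of_ereal) \<longlongrightarrow> 0) (at_right (-\<infinity>))"
      using at_bot unfolding ereal_tendsto_simps by (subst tendsto_norm_zero_iff[symmetric]) (simp add: nF)
    show "((F \<circ> real_of_ereal) \<longlongrightarrow> 0) (at_left \<infinity>)"
      using at_top unfolding ereal_tendsto_simps by (subst tendsto_norm_zero_iff[symmetric]) (simp add: nF)
  qed (use dF contF in auto)
  then have "(\<integral>x. F' x \<partial>lborel) = 0"
    by (simp add: interval_integral_to_infinity_eq interval_lebesgue_integral_def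
      set_lebesgue_integral_def einterval_def)
  then have "(\<integral>x. std_normal_density x *\<^sub>R f' x \<partial>lborel) = (\<integral>x. std_normal_density x *\<^sub>R (x * f x) \<partial>lborel)"
    unfolding F'_def using i1 i2 by simp
  then show ?thesis
    by (subst (1 2) integral_density) auto
qed

text \<open>The Gaussian part of the differential equation is removed by an integrating factor,
  which leaves only \<open>r\<close> to estimate. The constant is 1 + 1/2, one summand for each term
  of \<open>r\<close>: the second term carries \<beta>^2 / 2, which is at most q / 2.\<close>

lemma char_quadratic_std_normal_bound:
  fixes l \<beta> u :: real
  shows "cmod ((\<integral>x. iexp (u * (l * (x\<^sup>2 - 1) / 2 + \<beta> * x)) \<partial>std_normal_distribution)
                - exp (- (u\<^sup>2 * (l\<^sup>2 / 2 + \<beta>\<^sup>2) / 2)))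
         \<le> 3/2 * \<bar>u\<bar> ^ 3 * (\<bar>l\<bar> * (l\<^sup>2 / 2 + \<beta>\<^sup>2))"
proof -
  interpret N: real_distribution std_normal_distribution
    by (rule real_dist_normal_dist)
  define X where "X x = l * (x\<^sup>2 - 1) / 2 + \<beta> * x" for x
  define q where "q = l\<^sup>2 / 2 + \<beta>\<^sup>2"
  define \<phi> where "\<phi> v = (\<integral>x. iexp (v * X x) \<partial>std_normal_distribution)" for v
  define E1 where "E1 v = (\<integral>x. of_real x * iexp (v * X x) \<partial>std_normal_distribution)" for v
  define E2 where "E2 v = (\<integral>x. of_real x * (of_real x * iexp (v * X x)) \<partial>std_normal_distribution)" for v
  \<comment> \<open>The inverse of the coefficient that both Stein relations put in front of their
    unknown. The denominator has real part 1, so it never vanishes and \<open>a v\<close> has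
    modulus at most 1.\<close>
  define a where "a v = 1 / (1 - \<i> * of_real (v * l))" for v :: real
  note mom = integrable_std_normal_distribution_moment
  have X_meas [measurable]: "X \<in> borel_measurable borel"
    unfolding X_def by measurable
  have int0: "integrable std_normal_distribution (\<lambda>x. iexp (v * X x))" for v
    by (rule N.integrable_const_bound[where B=1]) auto
  have int1: "integrable std_normal_distribution (\<lambda>x. of_real x * iexp (v * X x))" for v
    by (rule Bochner_Integration.integrable_bound[OF mom[of 1]]) (auto simp: norm_mult)
  have int2: "integrable std_normal_distribution (\<lambda>x. of_real x * (of_real x * iexp (v * X x)))" for v
    by (rule Bochner_Integration.integrable_bound[OF mom[of 2]]) (auto simp: norm_mult power2_eq_square)
  note ints = int0[simplified] int1[simplified] int2[simplified]
  \<comment> \<open>The second moment of \<open>X\<close> controls the remainder when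
    \<open>\<phi>\<close> is differentiated under the integral.\<close>
  have intX: "integrable std_normal_distribution (\<lambda>x. (X x)\<^sup>2)"
  proof -
    have "(\<lambda>x. (X x)\<^sup>2) = (\<lambda>x. l\<^sup>2/4 * x^4 + l * \<beta> * x^3 + (\<beta>\<^sup>2 - l\<^sup>2/2) * x^2 + (- l * \<beta>) * x^1 + l\<^sup>2/4 * x^0)"
      by (auto simp: X_def fun_eq_iff algebra_simps power2_eq_square power3_eq_cube power4_eq_xxxx field_simps)
    then show ?thesis
      by (simp only:) (intro Bochner_Integration.integrable_add integrable_mult_right mom)
  qed
  \<comment> \<open>Boundary conditions for Stein's identity, which is applied to functions of
    modulus \<open>1\<close> and \<open>\<bar>x\<bar>\<close>.\<close>
  have lim: "((\<lambda>x. std_normal_density x * 1) \<longlongrightarrow> 0) at_top" "((\<lambda>x. std_normal_density x * 1) \<longlongrightarrow> 0) at_bot"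
      "((\<lambda>x. std_normal_density x * \<bar>x\<bar>) \<longlongrightarrow> 0) at_top" "((\<lambda>x. std_normal_density x * \<bar>x\<bar>) \<longlongrightarrow> 0) at_bot"
    unfolding std_normal_density_def by real_asymp+
  have dX: "((\<lambda>x. iexp (v * X x)) has_vector_derivative \<i> * v * (l * x + \<beta>) * iexp (v * X x)) (at x)" for v x
  proof -
    have "((\<lambda>z. exp (\<i> * (v * (l * (z\<^sup>2 - 1) / 2 + \<beta> * z)))) has_field_derivative
        \<i> * v * (l * of_real x + \<beta>) * exp (\<i> * (v * (l * ((of_real x)\<^sup>2 - 1) / 2 + \<beta> * of_real x)))) (at (of_real x))"
      by (auto intro!: derivative_eq_intros simp: algebra_simps)
    from has_vector_derivative_real_field[OF this] show ?thesis
      by (simp add: X_def)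
  qed
  have contX: "continuous_on UNIV X"
    unfolding X_def by (intro continuous_intros) auto
  have split1: "\<i> * v * (l * x + \<beta>) * z = \<i> * v * l * (x * z) + \<i> * v * \<beta> * z" for v x :: real and z :: complex
    by (simp add: algebra_simps)
  txt \<open>Stein's identity applied to \<open>iexp (v X)\<close> and \<open>x iexp (v X)\<close> gives a linear system for the
    weighted expectations \<open>E1\<close> and \<open>E2\<close>, hence a closed form of \<open>\<phi>' / \<phi>\<close>.\<close>
  have E1_eq: "E1 v = \<i> * v * l * E1 v + \<i> * v * \<beta> * \<phi> v" for v
  proof -
    have "E1 v = (\<integral>x. \<i> * v * (l * x + \<beta>) * iexp (v * X x) \<partial>std_normal_distribution)"
      unfolding E1_def
    proof (rule stein_identity_std_normal[OF dX])
      show "integrable std_normal_distribution (\<lambda>x. \<i> * v * (l * x + \<beta>) * iexp (v * X x))"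
        unfolding split1 by (intro Bochner_Integration.integrable_add integrable_mult_right int0 int1)
    qed (use int1 lim contX in \<open>auto intro!: continuous_intros\<close>)
    also have "\<dots> = \<i> * v * l * E1 v + \<i> * v * \<beta> * \<phi> v"
      unfolding E1_def \<phi>_def split1 by (simp add: ints)
    finally show ?thesis .
  qed
  have split2: "x * (\<i> * v * (l * x + \<beta>) * z) + z = \<i> * v * l * (x * (x * z)) + \<i> * v * \<beta> * (x * z) + z"
    for v x :: real and z :: complex
    by (simp add: algebra_simps)
  have E2_eq: "E2 v = \<i> * v * l * E2 v + \<i> * v * \<beta> * E1 v + \<phi> v" for v
  proof -
    have "E2 v = (\<integral>x. x * (\<i> * v * (l * x + \<beta>) * iexp (v * X x)) + iexp (v * X x) \<partial>std_normal_distribution)"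
      unfolding E2_def
    proof (rule stein_identity_std_normal)
      show "((\<lambda>x. x * iexp (v * X x)) has_vector_derivative x * (\<i> * v * (l * x + \<beta>) * iexp (v * X x)) + iexp (v * X x)) (at x)" for x
        by (rule has_vector_derivative_eq_rhs[OF has_vector_derivative_mult[OF has_vector_derivative_of_real dX]])
           (auto intro!: derivative_eq_intros)
      show "integrable std_normal_distribution (\<lambda>x. x * (\<i> * v * (l * x + \<beta>) * iexp (v * X x)) + iexp (v * X x))"
        unfolding split2 by (intro Bochner_Integration.integrable_add integrable_mult_right int0 int1 int2)
    qed (use int2 lim contX in \<open>auto intro!: continuous_intros simp: norm_mult\<close>)
    also have "\<dots> = \<i> * v * l * E2 v + \<i> * v * \<beta> * E1 v + \<phi> v"
      unfolding E1_def E2_def \<phi>_def split2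
      by (simp add: ints)
    finally show ?thesis .
  qed
  have den: "1 - \<i> * of_real (v * l) \<noteq> 0" for v
    by (simp add: complex_eq_iff)
  have E1: "E1 v = \<i> * v * \<beta> * a v * \<phi> v" for v
    using E1_eq[of v] den[of v] by (simp add: a_def field_simps)
  have E2: "E2 v = a v * \<phi> v * (1 + (\<i> * v * \<beta>)\<^sup>2 * a v)" for v
  proof -
    have "E2 v * (1 - \<i> * of_real (v * l)) = \<i> * v * \<beta> * E1 v + \<phi> v"
      using E2_eq[of v] by (simp add: algebra_simps)
    then have "E2 v = a v * (\<i> * v * \<beta> * E1 v + \<phi> v)"
      using den[of v] by (simp add: a_def divide_simps mult.commute)
    then show ?thesis by (simp add: E1 power2_eq_square algebra_simps)
  qed
  define \<phi>' where "\<phi>' v = (\<integral>x. \<i> * X x * iexp (v * X x) \<partial>std_normal_distribution)" for v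
  have X_split: "\<i> * X x * z = \<i> * l / 2 * (x * (x * z)) + \<i> * \<beta> * (x * z) - \<i> * l / 2 * z" for x and z :: complex
    by (simp add: X_def field_simps power2_eq_square)
  have int\<phi>': "integrable std_normal_distribution (\<lambda>x. \<i> * X x * iexp (v * X x))" for v
    unfolding X_split
    by (intro Bochner_Integration.integrable_diff Bochner_Integration.integrable_add integrable_mult_right int0 int1 int2)
  have \<phi>'_eq: "\<phi>' v = \<i> * l / 2 * E2 v + \<i> * \<beta> * E1 v - \<i> * l / 2 * \<phi> v" for v
    unfolding \<phi>'_def X_split E1_def E2_def \<phi>_def
    by (simp add: ints)
  \<comment> \<open>What the logarithmic derivative has beyond \<open>- v * q\<close>: the first
    term is the error of replacing \<open>a v\<close> by 1 in \<open>- v * q * a v\<close>, the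
    second is the part of \<open>E2\<close> that is quadratic in \<beta>.\<close>
  define r where "r v = - \<i> * v\<^sup>2 * l * q * a v - \<i> * l * v\<^sup>2 * \<beta>\<^sup>2 * (a v)\<^sup>2 / 2" for v :: real
  have aa: "a v = 1 + \<i> * v * l * a v" for v
    using den[of v] by (simp add: a_def field_simps)
  have \<phi>'_r: "\<phi>' v = \<phi> v * (- v * q + r v)" for v
  proof -
    have 1: "\<phi>' v = \<phi> v * (\<i> * (l / 2 * (a v - 1) + l / 2 * (\<i> * v * \<beta>)\<^sup>2 * (a v)\<^sup>2 + \<beta>\<^sup>2 * \<i> * v * a v))"
      unfolding \<phi>'_eq E1 E2 by (simp add: algebra_simps power2_eq_square)
    have 2: "a v - 1 = \<i> * v * l * a v" using aa[of v] by (simp add: algebra_simps)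
    have "\<i> * (l / 2 * (a v - 1) + l / 2 * (\<i> * v * \<beta>)\<^sup>2 * (a v)\<^sup>2 + \<beta>\<^sup>2 * \<i> * v * a v)
        = - v * q * a v + - \<i> * l * v\<^sup>2 * \<beta>\<^sup>2 * (a v)\<^sup>2 / 2"
      unfolding 2 by (simp add: q_def field_simps power2_eq_square)
    also have "- v * q * a v = - v * q - \<i> * v\<^sup>2 * l * q * a v"
      by (subst aa) (simp add: algebra_simps power2_eq_square)
    finally show ?thesis unfolding 1 r_def by simp
  qed
  have a_le: "cmod (a v) \<le> 1" for v
  proof -
    have "1 \<le> cmod (1 - \<i> * of_real (v * l))"
      using abs_Re_le_cmod[of "1 - \<i> * of_real (v * l)"] by simp
    then show ?thesis by (simp add: a_def norm_divide)
  qed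
  have q0: "0 \<le> q" by (simp add: q_def)
  have r_le: "cmod (r v) \<le> 3/2 * v\<^sup>2 * (\<bar>l\<bar> * q)" for v
  proof -
    have "cmod (r v) \<le> cmod (- \<i> * v\<^sup>2 * l * q * a v) + cmod (\<i> * l * v\<^sup>2 * \<beta>\<^sup>2 * (a v)\<^sup>2 / 2)"
      unfolding r_def by (rule norm_triangle_ineq4)
    also have "\<dots> = (v\<^sup>2 * (\<bar>l\<bar> * q)) * cmod (a v) + (v\<^sup>2 * (\<bar>l\<bar> * \<beta>\<^sup>2) / 2) * (cmod (a v))\<^sup>2"
      using q0 by (simp add: norm_mult norm_power norm_divide)
    also have "\<dots> \<le> (v\<^sup>2 * (\<bar>l\<bar> * q)) * 1 + (v\<^sup>2 * (\<bar>l\<bar> * q) / 2) * 1"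
      using q0 a_le[of v]
      by (intro add_mono mult_mono divide_right_mono) (auto simp: q_def power_le_one)
    finally show ?thesis by (simp add: mult_ac)
  qed
  have d\<phi>: "(\<phi> has_vector_derivative \<phi>' v) (at v)" for v
  proof -
    define B where "B = (\<integral>x. (X x)\<^sup>2 / 2 \<partial>std_normal_distribution)"
    \<comment> \<open>Once the factor \<open>iexp (v * X x)\<close> of modulus 1 is taken out, this
      is the first-order Taylor estimate of \<open>exp\<close> on the imaginary axis at
      \<open>(w - v) * X x\<close>, integrated.\<close>
    have bound: "cmod (\<phi> w - \<phi> v - (w - v) *\<^sub>R \<phi>' v) \<le> (w - v)\<^sup>2 * B" for w
    proof -
      have eq: "\<phi> w - \<phi> v - (w - v) *\<^sub>R \<phi>' v =
        (\<integral>x. iexp (w * X x) - iexp (v * X x) - (w - v) *\<^sub>R (\<i> * X x * iexp (v * X x)) \<partial>std_normal_distribution)"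
        unfolding \<phi>_def \<phi>'_def using int0 int\<phi>'
        by (subst Bochner_Integration.integral_diff Bochner_Integration.integral_diff; simp)+
      have "cmod (\<phi> w - \<phi> v - (w - v) *\<^sub>R \<phi>' v) \<le> (\<integral>x. (w - v)\<^sup>2 * ((X x)\<^sup>2 / 2) \<partial>std_normal_distribution)"
        unfolding eq
      proof (rule order_trans[OF integral_norm_bound integral_mono])
        fix x
        have "iexp (w * X x) - iexp (v * X x) - (w - v) *\<^sub>R (\<i> * X x * iexp (v * X x))
          = iexp (v * X x) * (iexp ((w - v) * X x) - (\<Sum>k\<le>1. (\<i> * ((w - v) * X x))^k / fact k))"
          by (simp add: algebra_simps scaleR_conv_of_real flip: exp_add)
        then have "cmod (iexp (w * X x) - iexp (v * X x) - (w - v) *\<^sub>R (\<i> * X x * iexp (v * X x)))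
          = cmod (iexp ((w - v) * X x) - (\<Sum>k\<le>1. (\<i> * ((w - v) * X x))^k / fact k))"
          by (simp only: norm_mult norm_exp_i_times mult_1_left)
        also have "\<dots> \<le> \<bar>(w - v) * X x\<bar> ^ Suc 1 / fact (Suc 1)"
          by (rule iexp_approx1)
        also have "\<dots> = (w - v)\<^sup>2 * ((X x)\<^sup>2 / 2)"
          by (simp add: power_mult_distrib power2_eq_square abs_mult fact_numeral) (simp flip: abs_mult)
        finally show "cmod (iexp (w * X x) - iexp (v * X x) - (w - v) *\<^sub>R (\<i> * X x * iexp (v * X x)))
          \<le> (w - v)\<^sup>2 * ((X x)\<^sup>2 / 2)" .
      qed (intro integrable_norm Bochner_Integration.integrable_diff integrable_scaleR_right
          integrable_mult_right integrable_divide int0 int\<phi>' intX)+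
      also have "\<dots> = (w - v)\<^sup>2 * B" unfolding B_def by simp
      finally show ?thesis .
    qed
    have "((\<lambda>w. norm (\<phi> w - \<phi> v - (w - v) *\<^sub>R \<phi>' v) / norm (w - v)) \<longlongrightarrow> 0) (at v)"
    proof (rule tendsto_sandwich[where f="\<lambda>_. 0" and h="\<lambda>w. \<bar>w - v\<bar> * B"])
      show "((\<lambda>w. \<bar>w - v\<bar> * B) \<longlongrightarrow> 0) (at v)"
        by (rule tendsto_eq_rhs) (rule tendsto_intros | simp)+
      show "\<forall>\<^sub>F w in at v. norm (\<phi> w - \<phi> v - (w - v) *\<^sub>R \<phi>' v) / norm (w - v) \<le> \<bar>w - v\<bar> * B"
        unfolding eventually_at_filter
      proof (intro always_eventually allI impI)
        fix w assume "w \<noteq> v"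
        have eq: "(w - v)\<^sup>2 * B = \<bar>w - v\<bar> * B * norm (w - v)"
          by (simp add: power2_eq_square)
        from bound[of w, unfolded eq] \<open>w \<noteq> v\<close>
        show "norm (\<phi> w - \<phi> v - (w - v) *\<^sub>R \<phi>' v) / norm (w - v) \<le> \<bar>w - v\<bar> * B"
          by (subst pos_divide_le_eq) simp_all
      qed
    qed auto
    then show ?thesis
      unfolding has_vector_derivative_def has_derivative_iff_norm by (simp add: bounded_linear_scaleR_left)
  qed
  have \<phi>_le: "cmod (\<phi> v) \<le> 1" for v
  proof -
    have "cmod (\<phi> v) \<le> (\<integral>x. 1 \<partial>std_normal_distribution)"
      unfolding \<phi>_def by (rule order_trans[OF integral_norm_bound integral_mono]) (intro integrable_norm int0, auto)
    then show ?thesis using N.prob_space by simp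
  qed
  \<comment> \<open>With \<open>r\<close> equal to 0 this function would be constantly 1, so its
    variation measures the distance of \<open>\<phi>\<close> from the Gaussian.\<close>
  define G where "G v = exp (v\<^sup>2 * q / 2) *\<^sub>R \<phi> v" for v
  have dG: "(G has_vector_derivative exp (v\<^sup>2 * q / 2) *\<^sub>R (\<phi> v * r v)) (at v)" for v
  proof -
    have "((\<lambda>v. exp (v\<^sup>2 * q / 2)) has_real_derivative v * q * exp (v\<^sup>2 * q / 2)) (at v)"
      by (auto intro!: derivative_eq_intros)
    from has_vector_derivative_scaleR[OF this d\<phi>] show ?thesis
      unfolding G_def \<phi>'_r by (rule has_vector_derivative_eq_rhs) (simp add: scaleR_conv_of_real algebra_simps)
  qed
  \<comment> \<open>Mean value inequality on a symmetric interval, which covers both signs of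
    \<open>u\<close>. The bound \<open>cmod (\<phi> v) \<le> 1\<close> suffices for the size of
    \<open>\<phi>\<close>, and the exponential factor cancels when \<open>G\<close> is converted
    back.\<close>
  have "norm (G u - G 0) \<le> (exp (u\<^sup>2 * q / 2) * (3/2 * u\<^sup>2 * (\<bar>l\<bar> * q))) * norm (u - 0)"
  proof (rule differentiable_bound[where S="{-\<bar>u\<bar>..\<bar>u\<bar>}" and f'="\<lambda>v h. h *\<^sub>R (exp (v\<^sup>2 * q / 2) *\<^sub>R (\<phi> v * r v))"])
    fix v assume v: "v \<in> {-\<bar>u\<bar>..\<bar>u\<bar>}"
    then have v2: "v\<^sup>2 \<le> u\<^sup>2" by (intro abs_le_square_iff[THEN iffD1]) auto
    show "(G has_derivative (\<lambda>h. h *\<^sub>R (exp (v\<^sup>2 * q / 2) *\<^sub>R (\<phi> v * r v)))) (at v within {-\<bar>u\<bar>..\<bar>u\<bar>})"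
      using dG[of v] unfolding has_vector_derivative_def by (rule has_derivative_at_withinI)
    have "3/2 * v\<^sup>2 * (\<bar>l\<bar> * q) \<le> 3/2 * u\<^sup>2 * (\<bar>l\<bar> * q)"
      using v2 q0 by (intro mult_right_mono) auto
    with r_le[of v] have "cmod (r v) \<le> 3/2 * u\<^sup>2 * (\<bar>l\<bar> * q)"
      by (rule order_trans)
    then have "cmod (\<phi> v) * cmod (r v) \<le> 1 * (3/2 * u\<^sup>2 * (\<bar>l\<bar> * q))"
      using \<phi>_le[of v] by (intro mult_mono) auto
    moreover have "exp (v\<^sup>2 * q / 2) \<le> exp (u\<^sup>2 * q / 2)"
      using v2 q0 by (simp add: mult_right_mono)
    ultimately have "exp (v\<^sup>2 * q / 2) * (cmod (\<phi> v) * cmod (r v)) \<le> exp (u\<^sup>2 * q / 2) * (1 * (3/2 * u\<^sup>2 * (\<bar>l\<bar> * q)))"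
      by - (rule mult_mono, assumption+, auto)
    then have "norm (exp (v\<^sup>2 * q / 2) *\<^sub>R (\<phi> v * r v)) \<le> exp (u\<^sup>2 * q / 2) * (3/2 * u\<^sup>2 * (\<bar>l\<bar> * q))"
      by (simp add: norm_mult)
    then show "onorm (\<lambda>h. h *\<^sub>R (exp (v\<^sup>2 * q / 2) *\<^sub>R (\<phi> v * r v))) \<le> exp (u\<^sup>2 * q / 2) * (3/2 * u\<^sup>2 * (\<bar>l\<bar> * q))"
      by (intro onorm_le) (simp only: norm_scaleR[of _ "exp (v\<^sup>2 * q / 2) *\<^sub>R (\<phi> v * r v)"]
          real_norm_def mult.commute[of "\<bar>_\<bar>"], intro mult_right_mono, auto)
  qed auto
  moreover have "G 0 = 1" using N.prob_space by (simp add: G_def \<phi>_def)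
  moreover have "\<bar>u\<bar>^3 = \<bar>u\<bar> * u\<^sup>2"
    by (simp add: power2_eq_square power3_eq_cube)
  ultimately have *: "norm (G u - 1) \<le> exp (u\<^sup>2 * q / 2) * (3/2 * \<bar>u\<bar>^3 * (\<bar>l\<bar> * q))"
    by (simp add: mult_ac)
  have "\<phi> u - exp (- (u\<^sup>2 * q / 2)) = exp (- (u\<^sup>2 * q / 2)) *\<^sub>R (G u - 1)"
    by (simp add: G_def scaleR_diff_right mult_exp_exp of_real_def)
  then have "cmod (\<phi> u - exp (- (u\<^sup>2 * q / 2))) \<le> exp (- (u\<^sup>2 * q / 2)) * (exp (u\<^sup>2 * q / 2) * (3/2 * \<bar>u\<bar>^3 * (\<bar>l\<bar> * q)))"
    using * by simp
  also have "\<dots> = 3/2 * \<bar>u\<bar>^3 * (\<bar>l\<bar> * q)"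
    by (simp only: mult.assoc[symmetric] mult_exp_exp) simp
  finally show ?thesis
    unfolding \<phi>_def X_def q_def .
qed

section \<open>Affine change of variables for \<open>lborel_vec\<close>\<close>

text \<open>Fubini isolates coordinate \<open>k\<close>. With the other coordinates fixed,
  \<open>b_indep\<close> makes \<open>b\<close> a constant, and the inner integral is a
  one-dimensional affine substitution. A general \<open>b\<close> serves both for translations and
  for the off-diagonal part of a matrix row.\<close>

lemma nn_integral_PiM_lborel_affine_coordinate:
  fixes b :: "(nat \<Rightarrow> real) \<Rightarrow> real" and c :: real
  assumes k: "k < m" and c: "c \<noteq> 0"
    and b [measurable]: "b \<in> borel_measurable (\<Pi>\<^sub>M i\<in>{..<m}. lborel)"
    and b_indep: "\<And>x y. b (x(k := y)) = b x"
    and f [measurable]: "f \<in> borel_measurable (\<Pi>\<^sub>M i\<in>{..<m}. lborel)"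
  shows "ennreal \<bar>c\<bar> * (\<integral>\<^sup>+x. f (x(k := b x + c * x k)) \<partial>(\<Pi>\<^sub>M i\<in>{..<m}. lborel))
    = (\<integral>\<^sup>+x. f x \<partial>(\<Pi>\<^sub>M i\<in>{..<m}. lborel))"
proof -
  interpret product_sigma_finite "\<lambda>_::nat. lborel :: real measure" ..
  define I where "I = {..<m} - {k}"
  have I: "finite I" "k \<notin> I" and ins: "{..<m} = insert k I"
    using k by (auto simp: I_def)
  have upd: "(\<lambda>x. x(k := b x + c * x k)) \<in> (\<Pi>\<^sub>M i\<in>{..<m}. lborel) \<rightarrow>\<^sub>M (\<Pi>\<^sub>M i\<in>{..<m}. lborel)"
    by (rule measurable_fun_upd[where J="{..<m}"]) (use k in auto)
  note [measurable] = upd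
  have meas_g: "(\<lambda>x. f (x(k := b x + c * x k))) \<in> borel_measurable (\<Pi>\<^sub>M i\<in>insert k I. lborel)"
    unfolding ins[symmetric] by measurable
  have meas_f: "f \<in> borel_measurable (\<Pi>\<^sub>M i\<in>insert k I. lborel)"
    unfolding ins[symmetric] by measurable
  have inner: "(\<integral>\<^sup>+y. f (x(k := y)) \<partial>lborel)
      = ennreal \<bar>c\<bar> * (\<integral>\<^sup>+y. f ((x(k := y))(k := b (x(k := y)) + c * (x(k := y)) k)) \<partial>lborel)"
    if x: "x \<in> space (\<Pi>\<^sub>M i\<in>I. lborel)" for x
  proof -
    have "(\<lambda>y. f (x(k := y))) \<in> borel_measurable lborel"
      using measurable_comp[OF measurable_component_update meas_f, OF x I(2)] unfolding comp_def .
    then have "(\<lambda>y. f (x(k := y))) \<in> borel_measurable borel" by simp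
    from nn_integral_real_affine[OF this c, of "b x"] show ?thesis
      by (simp add: b_indep)
  qed
  have meas_inner: "(\<lambda>x. \<integral>\<^sup>+y. f ((x(k := y))(k := b (x(k := y)) + c * (x(k := y)) k)) \<partial>lborel)
      \<in> borel_measurable (\<Pi>\<^sub>M i\<in>I. lborel)"
    using meas_g by measurable
  show ?thesis
    unfolding ins product_nn_integral_insert[OF I meas_f] product_nn_integral_insert[OF I meas_g]
    by (subst nn_integral_cmult[symmetric, OF meas_inner]) (intro nn_integral_cong inner[symmetric])
qed

text \<open>\<open>n\<close> counts the coordinates already shifted. As \<open>f\<close> is
  arbitrary in the induction, the shift of one more coordinate is absorbed into the integrand before
  the induction hypothesis is applied.\<close>

lemma nn_integral_PiM_lborel_translate:
  fixes \<mu> :: "nat \<Rightarrow> real"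
  assumes "f \<in> borel_measurable (\<Pi>\<^sub>M i\<in>{..<m}. lborel)" and "n \<le> m"
  shows "(\<integral>\<^sup>+x. f (\<lambda>i. if i < n then \<mu> i + x i else x i) \<partial>(\<Pi>\<^sub>M i\<in>{..<m}. lborel))
    = (\<integral>\<^sup>+x. f x \<partial>(\<Pi>\<^sub>M i\<in>{..<m}. lborel))"
  using assms
proof (induction n arbitrary: f)
  case (Suc n)
  note [measurable] = Suc.prems(1)
  have "(\<lambda>x. x(n := \<mu> n + 1 * x n)) \<in> (\<Pi>\<^sub>M i\<in>{..<m}. lborel) \<rightarrow>\<^sub>M (\<Pi>\<^sub>M i\<in>{..<m}. lborel)"
    by (rule measurable_fun_upd[where J="{..<m}"]) (use Suc.prems in auto)
  note [measurable] = this
  have "(\<lambda>i. if i < Suc n then \<mu> i + x i else x i)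
      = (\<lambda>i. if i < n then \<mu> i + x i else x i)(n := \<mu> n + 1 * (\<lambda>i. if i < n then \<mu> i + x i else x i) n)" for x
    by (auto simp: fun_eq_iff)
  then have "(\<integral>\<^sup>+x. f (\<lambda>i. if i < Suc n then \<mu> i + x i else x i) \<partial>(\<Pi>\<^sub>M i\<in>{..<m}. lborel))
      = (\<integral>\<^sup>+x. f ((\<lambda>i. if i < n then \<mu> i + x i else x i)
          (n := \<mu> n + 1 * (\<lambda>i. if i < n then \<mu> i + x i else x i) n)) \<partial>(\<Pi>\<^sub>M i\<in>{..<m}. lborel))"
    by (simp only:)
  also have "\<dots> = (\<integral>\<^sup>+x. f (x(n := \<mu> n + 1 * x n)) \<partial>(\<Pi>\<^sub>M i\<in>{..<m}. lborel))"
    by (rule Suc.IH) (measurable, use Suc.prems in simp)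
  also have "\<dots> = (\<integral>\<^sup>+x. f x \<partial>(\<Pi>\<^sub>M i\<in>{..<m}. lborel))"
    using nn_integral_PiM_lborel_affine_coordinate[of n m 1 "\<lambda>_. \<mu> n" f] Suc.prems by simp
  finally show ?case .
qed simp

section \<open>Measurability and integration on spaces of vectors\<close>

lemma space_lborel_vec [simp]: "space (lborel_vec m) = carrier_vec m"
proof -
  have "v = Matrix.vec m (\<lambda>i\<in>{..<m}. v $ i)" if "v \<in> carrier_vec m" for v :: "real vec"
    using that by auto
  then show ?thesis
    by (fastforce simp: lborel_vec_def space_embed_measure space_PiM PiE_def)
qed

lemma measurable_vec: "Matrix.vec m \<in> (\<Pi>\<^sub>M i\<in>{..<m}. lborel) \<rightarrow>\<^sub>M lborel_vec m"
  unfolding lborel_vec_def by (rule measurable_embed_measure2'[OF inj_on_vec_PiM])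

lemma measurable_lborel_vecI:
  "(\<lambda>x. g (Matrix.vec m x)) \<in> (\<Pi>\<^sub>M i\<in>{..<m}. lborel) \<rightarrow>\<^sub>M N \<Longrightarrow> g \<in> lborel_vec m \<rightarrow>\<^sub>M N"
  unfolding lborel_vec_def by (rule measurable_embed_measure1)

lemma nn_integral_lborel_vec:
  "f \<in> borel_measurable (lborel_vec m) \<Longrightarrow>
    (\<integral>\<^sup>+z. f z \<partial>lborel_vec m) = (\<integral>\<^sup>+x. f (Matrix.vec m x) \<partial>(\<Pi>\<^sub>M i\<in>{..<m}. lborel))"
  unfolding lborel_vec_def by (rule nn_integral_embed_measure'[OF inj_on_vec_PiM])

text \<open>The coordinates restricted to \<open>{..<m}\<close> form an extensional function from
  which \<open>Matrix.vec m\<close> rebuilds the vector, so measurability can be tested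
  coordinatewise.\<close>

lemma measurable_into_lborel_vec:
  assumes "\<And>z. z \<in> space N \<Longrightarrow> g z \<in> carrier_vec m"
    and "\<And>i. i < m \<Longrightarrow> (\<lambda>z. g z $ i) \<in> borel_measurable N"
  shows "g \<in> N \<rightarrow>\<^sub>M lborel_vec m"
proof -
  have "(\<lambda>z. \<lambda>i\<in>{..<m}. g z $ i) \<in> N \<rightarrow>\<^sub>M (\<Pi>\<^sub>M i\<in>{..<m}. lborel)"
    by (rule measurable_restrict) (use assms(2) in auto)
  from measurable_compose[OF this measurable_vec]
  have "(\<lambda>z. Matrix.vec m (\<lambda>i\<in>{..<m}. g z $ i)) \<in> N \<rightarrow>\<^sub>M lborel_vec m" .
  moreover have "Matrix.vec m (\<lambda>i\<in>{..<m}. g z $ i) = g z" if "z \<in> space N" for z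
    using assms(1)[OF that] by (intro eq_vecI) auto
  ultimately show ?thesis
    by (rule measurable_cong[THEN iffD1, rotated])
qed

lemma measurable_vec_index: "i < m \<Longrightarrow> (\<lambda>z. z $ i) \<in> borel_measurable (lborel_vec m)"
  by (rule measurable_lborel_vecI) simp

lemma measurable_affine_vec:
  assumes "M \<in> carrier_mat m m" "\<mu> \<in> carrier_vec m"
  shows "(\<lambda>z. \<mu> + M *\<^sub>v z) \<in> lborel_vec m \<rightarrow>\<^sub>M lborel_vec m"
proof (rule measurable_into_lborel_vec)
  fix i assume i: "i < m"
  have "(\<lambda>z. \<mu> $ i + (\<Sum>j<m. M $$ (i, j) * z $ j)) \<in> borel_measurable (lborel_vec m)"
    by (intro borel_measurable_add borel_measurable_sum borel_measurable_times measurable_vec_index) auto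
  also have "?this \<longleftrightarrow> (\<lambda>z. (\<mu> + M *\<^sub>v z) $ i) \<in> borel_measurable (lborel_vec m)"
    using assms i by (intro measurable_cong) (auto simp: scalar_prod_def atLeast0LessThan)
  finally show "(\<lambda>z. (\<mu> + M *\<^sub>v z) $ i) \<in> borel_measurable (lborel_vec m)" .
qed (use assms in auto)

lemma measurable_linear_vec:
  assumes "M \<in> carrier_mat m m"
  shows "(\<lambda>z. M *\<^sub>v z) \<in> lborel_vec m \<rightarrow>\<^sub>M lborel_vec m"
proof -
  have "(\<lambda>z. 0\<^sub>v m + M *\<^sub>v z) \<in> lborel_vec m \<rightarrow>\<^sub>M lborel_vec m"
    using assms by (intro measurable_affine_vec) auto
  also have "?this \<longleftrightarrow> ?thesis"
    using assms by (intro measurable_cong) auto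
  finally show ?thesis .
qed

text \<open>These matrices change a single coordinate, so Fubini's theorem reduces their action to a
  one-dimensional affine substitution. Column elimination factors every invertible matrix into them.\<close>

definition replace_row_id :: "nat \<Rightarrow> nat \<Rightarrow> (nat \<Rightarrow> real) \<Rightarrow> real mat" where
  "replace_row_id m k v = Matrix.mat m m (\<lambda>(i, j). if i = k then v j else if i = j then 1 else 0)"

lemma replace_row_id_carrier [simp]: "replace_row_id m k v \<in> carrier_mat m m"
  by (simp add: replace_row_id_def)

text \<open>Column \<open>k\<close> vanishes off the diagonal, and deleting row and column
  \<open>k\<close> leaves an identity matrix.\<close>

lemma det_replace_row_id:
  assumes k: "k < m"
  shows "Determinant.det (replace_row_id m k v) = v k"
proof -
  let ?A = "replace_row_id m k v"
  have del: "mat_delete ?A k k = 1\<^sub>m (m - 1)"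
    using k by (intro eq_matI) (auto simp: mat_delete_def replace_row_id_def)
  have "Determinant.det ?A = (\<Sum>i<m. ?A $$ (i, k) * cofactor ?A i k)"
    by (rule laplace_expansion_column[OF replace_row_id_carrier k])
  also have "\<dots> = (\<Sum>i<m. if i = k then v k * cofactor ?A k k else 0)"
    using k by (intro sum.cong) (auto simp: replace_row_id_def)
  also have "\<dots> = v k"
    using k by (simp add: cofactor_def del)
  finally show ?thesis .
qed

text \<open>Right multiplication is a column operation: column \<open>k\<close> is scaled by
  \<open>v k\<close>, and \<open>v j\<close> times the old column \<open>k\<close> is added to every
  other column \<open>j\<close>.\<close>

lemma mult_replace_row_id_index:
  assumes "M \<in> carrier_mat m m" "k < m" "i < m" "j < m"
  shows "(M * replace_row_id m k v) $$ (i, j) = (if j = k then 0 else M $$ (i, j)) + M $$ (i, k) * v j"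
proof -
  have "(M * replace_row_id m k v) $$ (i, j)
      = (\<Sum>r<m. M $$ (i, r) * (if r = k then v j else if r = j then 1 else 0))"
    using assms by (simp add: replace_row_id_def scalar_prod_def atLeast0LessThan)
  also have "\<dots> = (\<Sum>r<m. (if r = k then M $$ (i, k) * v j else 0) + (if r = j then (if j = k then 0 else M $$ (i, j)) else 0))"
    by (intro sum.cong) auto
  finally show ?thesis
    using assms by (simp add: sum.distrib)
qed

text \<open>This is the change of variables formula with its Jacobian, not invariance of the
  measure. Keeping the determinant as a factor avoids division in \<open>ennreal\<close> and makes
  the property closed under products.\<close>

definition preserves_lborel_vec :: "nat \<Rightarrow> real mat \<Rightarrow> bool" where
  "preserves_lborel_vec m M \<longleftrightarrow> (\<forall>f \<in> borel_measurable (lborel_vec m).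
     ennreal \<bar>Determinant.det M\<bar> * (\<integral>\<^sup>+z. f (M *\<^sub>v z) \<partial>lborel_vec m) = (\<integral>\<^sup>+z. f z \<partial>lborel_vec m))"

lemma preserves_lborel_vec_mult:
  assumes "M \<in> carrier_mat m m" "N \<in> carrier_mat m m"
    and M: "preserves_lborel_vec m M" and N: "preserves_lborel_vec m N"
  shows "preserves_lborel_vec m (M * N)"
  unfolding preserves_lborel_vec_def
proof
  fix f :: "real vec \<Rightarrow> ennreal" assume f: "f \<in> borel_measurable (lborel_vec m)"
  have g: "(\<lambda>z. f (M *\<^sub>v z)) \<in> borel_measurable (lborel_vec m)"
    using measurable_compose[OF measurable_linear_vec[OF assms(1)] f] .
  have "(\<integral>\<^sup>+z. f ((M * N) *\<^sub>v z) \<partial>lborel_vec m) = (\<integral>\<^sup>+z. f (M *\<^sub>v (N *\<^sub>v z)) \<partial>lborel_vec m)"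
    using assms(1,2) by (intro nn_integral_cong) auto
  moreover have "ennreal \<bar>Determinant.det (M * N)\<bar> = ennreal \<bar>Determinant.det M\<bar> * ennreal \<bar>Determinant.det N\<bar>"
    by (simp add: det_mult[OF assms(1,2)] abs_mult ennreal_mult)
  ultimately show "ennreal \<bar>Determinant.det (M * N)\<bar> * (\<integral>\<^sup>+z. f ((M * N) *\<^sub>v z) \<partial>lborel_vec m)
      = (\<integral>\<^sup>+z. f z \<partial>lborel_vec m)"
    using M[unfolded preserves_lborel_vec_def, rule_format, OF f]
      N[unfolded preserves_lborel_vec_def, rule_format, OF g]
    by (simp add: mult.assoc)
qed

lemma preserves_lborel_vec_replace_row_id:
  assumes k: "k < m" and v: "v k \<noteq> 0"
  shows "preserves_lborel_vec m (replace_row_id m k v)"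
  unfolding preserves_lborel_vec_def
proof
  fix f :: "real vec \<Rightarrow> ennreal" assume f: "f \<in> borel_measurable (lborel_vec m)"
  let ?P = "\<Pi>\<^sub>M i\<in>{..<m}. (lborel :: real measure)"
  define b where "b x = (\<Sum>j\<in>{..<m} - {k}. v j * x j)" for x :: "nat \<Rightarrow> real"
  have b_meas: "b \<in> borel_measurable ?P"
    unfolding b_def by measurable
  have b_indep: "b (x(k := y)) = b x" for x y
    unfolding b_def by (intro sum.cong) auto
  have act: "replace_row_id m k v *\<^sub>v Matrix.vec m x = Matrix.vec m (x(k := b x + v k * x k))" for x
  proof (rule eq_vecI)
    fix i assume "i < dim_vec (Matrix.vec m (x(k := b x + v k * x k)))"
    then have i: "i < m" by simp
    have *: "(replace_row_id m k v *\<^sub>v Matrix.vec m x) $ i = (\<Sum>j<m. (if i = k then v j else if i = j then 1 else 0) * x j)"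
      using i by (simp add: replace_row_id_def scalar_prod_def atLeast0LessThan)
    show "(replace_row_id m k v *\<^sub>v Matrix.vec m x) $ i = Matrix.vec m (x(k := b x + v k * x k)) $ i"
    proof (cases "i = k")
      case True
      then show ?thesis unfolding * using i by (simp add: b_def sum.remove[of "{..<m}" k])
    next
      case False
      then have "(\<Sum>j<m. (if i = k then v j else if i = j then 1 else 0) * x j) = (\<Sum>j<m. if j = i then x i else 0)"
        by (intro sum.cong) auto
      then show ?thesis unfolding * using i False by simp
    qed
  qed (simp add: replace_row_id_def)
  have fM: "(\<lambda>z. f (replace_row_id m k v *\<^sub>v z)) \<in> borel_measurable (lborel_vec m)"
    using measurable_compose[OF measurable_linear_vec[OF replace_row_id_carrier] f] .
  show "ennreal \<bar>Determinant.det (replace_row_id m k v)\<bar> * (\<integral>\<^sup>+z. f (replace_row_id m k v *\<^sub>v z) \<partial>lborel_vec m)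
      = (\<integral>\<^sup>+z. f z \<partial>lborel_vec m)"
    unfolding nn_integral_lborel_vec[OF f] nn_integral_lborel_vec[OF fM] act det_replace_row_id[OF k]
    by (rule nn_integral_PiM_lborel_affine_coordinate[OF k v b_meas b_indep measurable_compose[OF measurable_vec f]])
qed

text \<open>Column elimination as a downward induction on the number \<open>k\<close> of leading
  rows that already agree with the identity. At \<open>k = m\<close> the matrix is the identity;
  each step splits off factors of the form \<open>replace_row_id\<close> on the right.\<close>

lemma preserves_lborel_vec_unit_rows:
  assumes "M \<in> carrier_mat m m" "Determinant.det M \<noteq> 0" "k \<le> m"
    and "\<And>i j. i < k \<Longrightarrow> j < m \<Longrightarrow> M $$ (i, j) = (if i = j then 1 else 0)"
  shows "preserves_lborel_vec m M"
  using \<open>k \<le> m\<close> assms(1,2,4)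
proof (induction arbitrary: M rule: inc_induct)
  case base
  then have "M = 1\<^sub>m m" by (intro eq_matI) auto
  then show ?case
    by (auto simp: preserves_lborel_vec_def intro!: nn_integral_cong)
next
  case (step k)
  then have k: "k < m" by simp
  have pivot: "preserves_lborel_vec m M"
    if M: "M \<in> carrier_mat m m" "Determinant.det M \<noteq> 0"
      and rows: "\<And>i j. i < k \<Longrightarrow> j < m \<Longrightarrow> M $$ (i, j) = (if i = j then 1 else 0)"
      and nz: "M $$ (k, k) \<noteq> 0" for M
  proof -
    define v where "v j = M $$ (k, j)" for j
    \<comment> \<open>\<open>M\<close> times the inverse of \<open>replace_row_id m k v\<close>:
      dividing by the pivot turns row \<open>k\<close> into a unit row. Rows above it stay unit rows
      because their entry in column \<open>k\<close> is 0.\<close>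
    define M' where "M' = Matrix.mat m m (\<lambda>(i, j).
      if j = k then M $$ (i, k) / v k else M $$ (i, j) - M $$ (i, k) * v j / v k)"
    have M': "M' \<in> carrier_mat m m" by (simp add: M'_def)
    have vk: "v k \<noteq> 0" using nz by (simp add: v_def)
    have eq: "M = M' * replace_row_id m k v"
    proof (rule eq_matI)
      fix i j assume "i < dim_row (M' * replace_row_id m k v)" "j < dim_col (M' * replace_row_id m k v)"
      then have ij: "i < m" "j < m" by (auto simp: M'_def replace_row_id_def)
      then show "M $$ (i, j) = (M' * replace_row_id m k v) $$ (i, j)"
        unfolding mult_replace_row_id_index[OF M' k ij] using k vk by (simp add: M'_def)
    qed (use M in \<open>auto simp: M'_def replace_row_id_def\<close>)
    have "Determinant.det M = Determinant.det M' * v k"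
      unfolding eq by (simp add: det_mult[OF M' replace_row_id_carrier] det_replace_row_id[OF k])
    then have det: "Determinant.det M' \<noteq> 0" using M by auto
    have "preserves_lborel_vec m M'"
    proof (rule step.IH[OF M' det])
      fix i j assume ij: "i < Suc k" "j < m"
      show "M' $$ (i, j) = (if i = j then 1 else 0)"
      proof (cases "i = k")
        case True
        then show ?thesis using ij k vk by (cases "j = k") (simp_all add: M'_def v_def)
      next
        case False
        then have "i < k" using ij by simp
        then have "M $$ (i, k) = 0" using rows[of i k] k by simp
        then show ?thesis using ij k \<open>i < k\<close> rows[of i j] by (cases "i = j") (simp_all add: M'_def)
      qed
    qed
    then show ?thesis
      unfolding eq by (intro preserves_lborel_vec_mult M' preserves_lborel_vec_replace_row_id k vk) auto
  qed
  show ?case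
  proof (cases "M $$ (k, k) = 0")
    case False
    then show ?thesis using pivot step.prems by blast
  next
    case True
    have "\<exists>r<m. k < r \<and> M $$ (k, r) \<noteq> 0"
    proof (rule ccontr)
      assume no: "\<not> ?thesis"
      \<comment> \<open>If row \<open>k\<close> vanished from the diagonal on, it would be a
        combination of the unit rows above it. The vector \<open>x\<close> records this relation and
        lies in the left kernel, against the nonzero determinant.\<close>
      define x where "x = Matrix.vec m (\<lambda>i. if i = k then 1 else if i < k then - M $$ (k, i) else 0)"
      have x: "x \<in> carrier_vec m" by (simp add: x_def)
      have "x $ k = 1" using k by (simp add: x_def)
      then have x0: "x \<noteq> 0\<^sub>v m" using k by auto
      have "transpose_mat M *\<^sub>v x = 0\<^sub>v m"
      proof (rule eq_vecI)
        fix j assume "j < dim_vec (0\<^sub>v m :: real vec)"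
        then have j: "j < m" by simp
        have "(transpose_mat M *\<^sub>v x) $ j = (\<Sum>i<m. M $$ (i, j) * x $ i)"
          using j step.prems(1) x by (simp add: scalar_prod_def atLeast0LessThan)
        also have "\<dots> = (\<Sum>i<m. (if i = k then M $$ (k, j) else 0) + (if i = j then (if j < k then - M $$ (k, j) else 0) else 0))"
          using j step.prems(3) by (intro sum.cong) (auto simp: x_def)
        also have "\<dots> = M $$ (k, j) + (if j < k then - M $$ (k, j) else 0)"
          using j k by (simp add: sum.distrib)
        also have "\<dots> = 0" using no True j by (cases j k rule: linorder_cases) auto
        finally show "(transpose_mat M *\<^sub>v x) $ j = 0\<^sub>v m $ j" using j by simp
      qed (use step.prems(1) in auto)
      then have "Determinant.det (transpose_mat M) = 0"
        using x x0 step.prems(1) by (subst det_0_iff_vec_prod_zero[of _ m]) auto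
      then show False using step.prems(1,2) by (simp add: det_transpose)
    qed
    then obtain r where r: "r < m" "k < r" "M $$ (k, r) \<noteq> 0" by blast
    \<comment> \<open>\<open>M'\<close> arises by adding column \<open>r\<close> to column
      \<open>k\<close>, which produces a nonzero pivot; the factor with row \<open>v\<close>
      subtracts it again and has determinant 1. Both columns vanish in the rows above
      \<open>k\<close>, so these rows are kept.\<close>
    define v where "v j = (if j = r then 1 else if j = k then -1 else (0::real))" for j
    define M' where "M' = Matrix.mat m m (\<lambda>(i, j). if j = k then M $$ (i, k) + M $$ (i, r) else M $$ (i, j))"
    have M': "M' \<in> carrier_mat m m" by (simp add: M'_def)
    have vr: "v r \<noteq> 0" by (simp add: v_def)
    have eq: "M = M' * replace_row_id m r v"
    proof (rule eq_matI)
      fix i j assume "i < dim_row (M' * replace_row_id m r v)" "j < dim_col (M' * replace_row_id m r v)"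
      then have ij: "i < m" "j < m" by (auto simp: M'_def replace_row_id_def)
      then show "M $$ (i, j) = (M' * replace_row_id m r v) $$ (i, j)"
        unfolding mult_replace_row_id_index[OF M' r(1) ij] using k r by (auto simp: M'_def v_def)
    qed (use step.prems in \<open>auto simp: M'_def replace_row_id_def\<close>)
    have "Determinant.det M = Determinant.det M' * v r"
      unfolding eq by (simp add: det_mult[OF M' replace_row_id_carrier] det_replace_row_id[OF r(1)])
    then have det: "Determinant.det M' \<noteq> 0" using step.prems by auto
    have "preserves_lborel_vec m M'"
      using k r True step.prems(3) by (intro pivot M' det) (auto simp: M'_def)
    then show ?thesis
      unfolding eq by (intro preserves_lborel_vec_mult M' preserves_lborel_vec_replace_row_id r vr) auto
  qed
qed

lemma nn_integral_lborel_vec_affine: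
  assumes M: "M \<in> carrier_mat m m" "Determinant.det M \<noteq> 0" and \<mu>: "\<mu> \<in> carrier_vec m"
    and f: "f \<in> borel_measurable (lborel_vec m)"
  shows "ennreal \<bar>Determinant.det M\<bar> * (\<integral>\<^sup>+z. f (\<mu> + M *\<^sub>v z) \<partial>lborel_vec m) = (\<integral>\<^sup>+z. f z \<partial>lborel_vec m)"
proof -
  have tr: "(\<lambda>z. f (\<mu> + z)) \<in> borel_measurable (lborel_vec m)"
  proof -
    have "(\<lambda>z. f (\<mu> + 1\<^sub>m m *\<^sub>v z)) \<in> borel_measurable (lborel_vec m)"
      by (rule measurable_compose[OF measurable_affine_vec f]) (use \<mu> in auto)
    also have "?this \<longleftrightarrow> ?thesis" by (intro measurable_cong) auto
    finally show ?thesis .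
  qed
  \<comment> \<open>For \<open>k = 0\<close> the condition on the rows is vacuous.\<close>
  have "preserves_lborel_vec m M"
    by (rule preserves_lborel_vec_unit_rows[where k=0]) (use M in auto)
  from this[unfolded preserves_lborel_vec_def, rule_format, OF tr]
  have "ennreal \<bar>Determinant.det M\<bar> * (\<integral>\<^sup>+z. f (\<mu> + M *\<^sub>v z) \<partial>lborel_vec m) = (\<integral>\<^sup>+z. f (\<mu> + z) \<partial>lborel_vec m)" .
  also have "\<dots> = (\<integral>\<^sup>+x. f (Matrix.vec m (\<lambda>i. if i < m then \<mu> $ i + x i else x i)) \<partial>(\<Pi>\<^sub>M i\<in>{..<m}. lborel))"
    unfolding nn_integral_lborel_vec[OF tr] using \<mu>
    by (intro nn_integral_cong arg_cong[where f=f]) auto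
  also have "\<dots> = (\<integral>\<^sup>+z. f z \<partial>lborel_vec m)"
    unfolding nn_integral_lborel_vec[OF f]
    by (rule nn_integral_PiM_lborel_translate[OF measurable_compose[OF measurable_vec f]]) simp
  finally show ?thesis .
qed

section \<open>Gaussian laws as images of the standard normal product\<close>

text \<open>Integrals of products of functions of single coordinates factorise. After expanding the
  square, each mixed term contains a factor of mean 0, and only the diagonal remains.\<close>

lemma product_centered_sum:
  fixes M :: "'i \<Rightarrow> 'a measure" and g :: "'i \<Rightarrow> 'a \<Rightarrow> real"
  assumes "\<And>i. prob_space (M i)" and I: "finite I"
    and int1: "\<And>i. i \<in> I \<Longrightarrow> integrable (M i) (g i)"
    and int2: "\<And>i. i \<in> I \<Longrightarrow> integrable (M i) (\<lambda>x. (g i x)\<^sup>2)"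
    and mean: "\<And>i. i \<in> I \<Longrightarrow> (\<integral>x. g i x \<partial>M i) = 0"
  shows "has_bochner_integral (PiM I M) (\<lambda>x. \<Sum>i\<in>I. g i (x i)) 0"
    and "has_bochner_integral (PiM I M) (\<lambda>x. (\<Sum>i\<in>I. g i (x i))\<^sup>2) (\<Sum>i\<in>I. \<integral>x. (g i x)\<^sup>2 \<partial>M i)"
proof -
  interpret M: prob_space "M i" for i by fact
  interpret product_sigma_finite M ..
  have single: "has_bochner_integral (PiM I M) (\<lambda>x. g i (x i)) 0" if i: "i \<in> I" for i
  proof -
    let ?f = "\<lambda>k x. if k = i then g i x else 1"
    have f: "integrable (M k) (?f k)" if "k \<in> I" for k
      using int1[OF i] by (cases "k = i") auto
    have eq: "(\<Prod>k\<in>I. ?f k (x k)) = g i (x i)" for x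
      using i I by simp
    have "(\<integral>x. g i (x i) \<partial>PiM I M) = (\<Prod>k\<in>I. \<integral>x. ?f k x \<partial>M k)"
      using product_integral_prod[OF I f] unfolding eq by simp
    also have "\<dots> = 0"
      using i I mean[OF i] by (intro prod_zero bexI[of _ i]) auto
    finally show ?thesis
      using product_integrable_prod[OF I f] unfolding eq by (simp add: has_bochner_integral_iff)
  qed
  show "has_bochner_integral (PiM I M) (\<lambda>x. \<Sum>i\<in>I. g i (x i)) 0"
    using has_bochner_integral_sum[of I "PiM I M" "\<lambda>i x. g i (x i)" "\<lambda>_. 0", OF single] by simp
  have pair: "has_bochner_integral (PiM I M) (\<lambda>x. g i (x i) * g j (x j))
      (if i = j then \<integral>x. (g i x)\<^sup>2 \<partial>M i else 0)" if ij: "i \<in> I" "j \<in> I" for i j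
  proof -
    \<comment> \<open>Two separate conditionals, so that for \<open>i = j\<close> they multiply to a
      square in one coordinate, and all remaining coordinates contribute 1.\<close>
    let ?f = "\<lambda>k x. (if k = i then g i x else 1) * (if k = j then g j x else 1)"
    have f: "integrable (M k) (?f k)" if "k \<in> I" for k
      using int1[OF ij(1)] int1[OF ij(2)] int2[OF ij(1)]
      by (cases "k = i"; cases "k = j") (auto simp: power2_eq_square)
    have eq: "(\<Prod>k\<in>I. ?f k (x k)) = g i (x i) * g j (x j)" for x
      using ij I by (simp add: prod.distrib)
    have "(\<integral>x. g i (x i) * g j (x j) \<partial>PiM I M) = (\<Prod>k\<in>I. \<integral>x. ?f k x \<partial>M k)"
      using product_integral_prod[OF I f] unfolding eq by simp
    also have "\<dots> = (if i = j then \<integral>x. (g i x)\<^sup>2 \<partial>M i else 0)"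
    proof (cases "i = j")
      case True
      have "(\<Prod>k\<in>I. \<integral>x. ?f k x \<partial>M k) = (\<Prod>k\<in>I. if k = i then \<integral>x. (g i x)\<^sup>2 \<partial>M i else 1)"
        using True by (intro prod.cong) (auto simp: power2_eq_square M.prob_space)
      then show ?thesis using True I ij by simp
    next
      case False
      then show ?thesis using ij I mean[OF ij(1)] by (simp, intro bexI[of _ i]) auto
    qed
    finally show ?thesis
      using product_integrable_prod[OF I f] unfolding eq by (simp add: has_bochner_integral_iff)
  qed
  have "has_bochner_integral (PiM I M) (\<lambda>x. \<Sum>i\<in>I. \<Sum>j\<in>I. g i (x i) * g j (x j))
      (\<Sum>i\<in>I. \<Sum>j\<in>I. if i = j then \<integral>x. (g i x)\<^sup>2 \<partial>M i else 0)"
    by (intro has_bochner_integral_sum pair)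
  then show "has_bochner_integral (PiM I M) (\<lambda>x. (\<Sum>i\<in>I. g i (x i))\<^sup>2) (\<Sum>i\<in>I. \<integral>x. (g i x)\<^sup>2 \<partial>M i)"
    using I by (simp add: power2_eq_square sum_product)
qed

text \<open>A combination of the first two nonconstant Hermite polynomials. They are centred and
  orthogonal under the standard normal law, with squared norms 1 and 2, whence the variance
  \<open>l\<^sup>2 / 2 + \<beta>\<^sup>2\<close>.\<close>

definition centered_quadratic :: "real \<Rightarrow> real \<Rightarrow> real \<Rightarrow> real" where
  "centered_quadratic l \<beta> x = l * (x\<^sup>2 - 1) / 2 + \<beta> * x"

lemma centered_quadratic_std_normal_moments:
  shows "has_bochner_integral std_normal_distribution (centered_quadratic l \<beta>) 0"
    and "has_bochner_integral std_normal_distribution (\<lambda>x. (centered_quadratic l \<beta> x)\<^sup>2) (l\<^sup>2 / 2 + \<beta>\<^sup>2)"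
proof -
  have m: "has_bochner_integral std_normal_distribution (\<lambda>x. x ^ k) (\<integral>x. x ^ k \<partial>std_normal_distribution)" for k
    using integrable_std_normal_distribution_moment by (rule has_bochner_integral_integrable)
  have odd: "(\<integral>x. x ^ 1 \<partial>std_normal_distribution) = 0" "(\<integral>x. x ^ 3 \<partial>std_normal_distribution) = 0"
    by (intro integral_std_normal_distribution_moment_odd; simp)+
  have even: "(\<integral>x. x ^ 0 \<partial>std_normal_distribution) = 1" "(\<integral>x. x ^ 2 \<partial>std_normal_distribution) = 1"
      "(\<integral>x. x ^ 4 \<partial>std_normal_distribution) = 3"
    using std_normal_distribution_even_moments(1)[of 0] std_normal_distribution_even_moments(1)[of 1]
      std_normal_distribution_even_moments(1)[of 2] by (simp_all add: fact_numeral)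
  note moments = m[of 0, unfolded even] m[of 1, unfolded odd] m[of 2, unfolded even] m[of 3, unfolded odd]
    m[of 4, unfolded even]
  have "has_bochner_integral std_normal_distribution (\<lambda>x. l/2 * x^2 + \<beta> * x^1 + (- (l/2)) * x^0)
      (l/2 * 1 + \<beta> * 0 + (- (l/2)) * 1)"
    by (intro has_bochner_integral_add has_bochner_integral_mult_right moments)
  then show "has_bochner_integral std_normal_distribution (centered_quadratic l \<beta>) 0"
    by (rule has_bochner_integral_cong[THEN iffD1, rotated -1])
       (auto simp: centered_quadratic_def field_simps)
  have "has_bochner_integral std_normal_distribution
      (\<lambda>x. l\<^sup>2/4 * x^4 + l * \<beta> * x^3 + (\<beta>\<^sup>2 - l\<^sup>2/2) * x^2 + (- l * \<beta>) * x^1 + l\<^sup>2/4 * x^0)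
      (l\<^sup>2/4 * 3 + l * \<beta> * 0 + (\<beta>\<^sup>2 - l\<^sup>2/2) * 1 + (- l * \<beta>) * 0 + l\<^sup>2/4 * 1)"
    by (intro has_bochner_integral_add has_bochner_integral_mult_right moments)
  then show "has_bochner_integral std_normal_distribution (\<lambda>x. (centered_quadratic l \<beta> x)\<^sup>2) (l\<^sup>2 / 2 + \<beta>\<^sup>2)"
    by (rule has_bochner_integral_cong[THEN iffD1, rotated -1])
       (auto simp: centered_quadratic_def field_simps power2_eq_square power3_eq_cube power4_eq_xxxx)
qed

abbreviation std_normal_PiM :: "nat \<Rightarrow> (nat \<Rightarrow> real) measure" where
  "std_normal_PiM m \<equiv> \<Pi>\<^sub>M i\<in>{..<m}. std_normal_distribution"

text \<open>Both characteristic functions are products over the coordinates with all factors of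
  modulus at most 1, so replacing the factors one at a time makes the errors add without
  amplification.\<close>

lemma char_sum_centered_quadratic_bound:
  fixes l \<beta> :: "nat \<Rightarrow> real" and u :: real
  shows "cmod ((\<integral>y. iexp (u * (\<Sum>j<m. centered_quadratic (l j) (\<beta> j) (y j))) \<partial>std_normal_PiM m)
                - exp (- (u\<^sup>2 * (\<Sum>j<m. (l j)\<^sup>2 / 2 + (\<beta> j)\<^sup>2) / 2)))
         \<le> 3/2 * \<bar>u\<bar> ^ 3 * (\<Sum>j<m. \<bar>l j\<bar> * ((l j)\<^sup>2 / 2 + (\<beta> j)\<^sup>2))"
proof -
  interpret N: real_distribution std_normal_distribution
    by (rule real_dist_normal_dist)
  interpret product_sigma_finite "\<lambda>_::nat. std_normal_distribution" ..
  define \<phi> where "\<phi> j = (\<integral>x. iexp (u * centered_quadratic (l j) (\<beta> j) x) \<partial>std_normal_distribution)" for j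
  define \<psi> where "\<psi> j = complex_of_real (exp (- (u\<^sup>2 * ((l j)\<^sup>2 / 2 + (\<beta> j)\<^sup>2) / 2)))" for j
  have [measurable]: "centered_quadratic a b \<in> borel_measurable borel" for a b
    unfolding centered_quadratic_def by measurable
  have int: "integrable std_normal_distribution (\<lambda>x. iexp (u * centered_quadratic a b x))" for a b
    by (rule N.integrable_const_bound[where B=1]) auto
  have "(\<integral>y. iexp (u * (\<Sum>j<m. centered_quadratic (l j) (\<beta> j) (y j))) \<partial>std_normal_PiM m)
      = (\<integral>y. (\<Prod>j<m. iexp (u * centered_quadratic (l j) (\<beta> j) (y j))) \<partial>std_normal_PiM m)"
    by (simp add: sum_distrib_left exp_sum)
  also have "\<dots> = (\<Prod>j<m. \<phi> j)"
    unfolding \<phi>_def by (rule product_integral_prod) (rule finite_lessThan, rule int)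
  finally have 1: "(\<integral>y. iexp (u * (\<Sum>j<m. centered_quadratic (l j) (\<beta> j) (y j))) \<partial>std_normal_PiM m)
      = (\<Prod>j<m. \<phi> j)" .
  have "exp (- (u\<^sup>2 * (\<Sum>j<m. (l j)\<^sup>2 / 2 + (\<beta> j)\<^sup>2) / 2))
      = (\<Prod>j<m. exp (- (u\<^sup>2 * ((l j)\<^sup>2 / 2 + (\<beta> j)\<^sup>2) / 2)))"
    by (simp add: exp_sum[symmetric] sum_distrib_left sum_negf sum_divide_distrib)
  then have 2: "complex_of_real (exp (- (u\<^sup>2 * (\<Sum>j<m. (l j)\<^sup>2 / 2 + (\<beta> j)\<^sup>2) / 2))) = (\<Prod>j<m. \<psi> j)"
    by (simp add: \<psi>_def)
  have "cmod (\<phi> j) \<le> 1" for j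
  proof -
    have "cmod (\<phi> j) \<le> (\<integral>x. 1 \<partial>std_normal_distribution)"
      unfolding \<phi>_def by (rule order_trans[OF integral_norm_bound integral_mono]) (intro integrable_norm int, auto)
    then show ?thesis using N.prob_space by simp
  qed
  then have "cmod ((\<Prod>j<m. \<phi> j) - (\<Prod>j<m. \<psi> j)) \<le> (\<Sum>j<m. cmod (\<phi> j - \<psi> j))"
    by (intro norm_prod_diff) (auto simp: \<psi>_def)
  also have "\<dots> \<le> (\<Sum>j<m. 3/2 * \<bar>u\<bar> ^ 3 * (\<bar>l j\<bar> * ((l j)\<^sup>2 / 2 + (\<beta> j)\<^sup>2)))"
    unfolding \<phi>_def \<psi>_def centered_quadratic_def by (intro sum_mono char_quadratic_std_normal_bound)
  finally show ?thesis
    unfolding 1 2 by (simp add: sum_distrib_left)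
qed

section \<open>Gaussian densities and affine images of the standard normal product\<close>

lemma PiM_std_normal_distribution:
  "std_normal_PiM m = density (\<Pi>\<^sub>M i\<in>{..<m}. lborel) (\<lambda>x. \<Prod>i<m. ennreal (std_normal_density (x i)))"
proof -
  interpret N: real_distribution std_normal_distribution
    by (rule real_dist_normal_dist)
  interpret L: product_sigma_finite "\<lambda>_::nat. lborel :: real measure" ..
  interpret S: product_sigma_finite "\<lambda>_::nat. std_normal_distribution" ..
  let ?P = "\<Pi>\<^sub>M i\<in>{..<m}. (lborel :: real measure)"
  let ?d = "\<lambda>x. \<Prod>i<m. ennreal (std_normal_density (x i))"
  \<comment> \<open>A finite product measure is determined by its values on boxes. There the density
    times the indicator is a product over the coordinates, and Tonelli applies.\<close>
  show ?thesis
  proof (rule S.PiM_eqI[symmetric])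
    show "sets (density ?P ?d) = sets (std_normal_PiM m)"
      by (simp, intro sets_PiM_cong) auto
    fix A :: "nat \<Rightarrow> real set" assume A: "\<And>i. i \<in> {..<m} \<Longrightarrow> A i \<in> sets std_normal_distribution"
    then have A': "A i \<in> sets borel" if "i < m" for i using that by simp
    have "emeasure (density ?P ?d) (Pi\<^sub>E {..<m} A) = (\<integral>\<^sup>+x. ?d x * indicator (Pi\<^sub>E {..<m} A) x \<partial>?P)"
      by (rule emeasure_density) (use A' in \<open>auto intro!: sets_PiM_I_finite\<close>)
    also have "\<dots> = (\<integral>\<^sup>+x. (\<Prod>i<m. ennreal (std_normal_density (x i)) * indicator (A i) (x i)) \<partial>?P)"
    proof (rule nn_integral_cong)
      fix x assume "x \<in> space ?P"
      then have "x \<in> Pi\<^sub>E {..<m} A \<longleftrightarrow> (\<forall>i<m. x i \<in> A i)"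
        by (auto simp: space_PiM PiE_iff)
      then have "indicator (Pi\<^sub>E {..<m} A) x = (\<Prod>i<m. indicator (A i) (x i) :: ennreal)"
        by (cases "\<forall>i<m. x i \<in> A i") (auto simp: indicator_def intro!: prod_zero[symmetric] split: if_splits)
      then show "?d x * indicator (Pi\<^sub>E {..<m} A) x
          = (\<Prod>i<m. ennreal (std_normal_density (x i)) * indicator (A i) (x i))"
        by (simp add: prod.distrib)
    qed
    also have "\<dots> = (\<Prod>i<m. \<integral>\<^sup>+x. ennreal (std_normal_density x) * indicator (A i) x \<partial>lborel)"
      by (rule L.product_nn_integral_prod) (use A' in auto)
    also have "\<dots> = (\<Prod>i<m. emeasure std_normal_distribution (A i))"
      using A' by (intro prod.cong) (auto simp: emeasure_density)
    finally show "emeasure (density ?P ?d) (Pi\<^sub>E {..<m} A) = (\<Prod>i<m. emeasure std_normal_distribution (A i))" .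
  qed simp
qed

lemma borel_measurable_scalar_prod:
  assumes "g \<in> N \<rightarrow>\<^sub>M lborel_vec m" "h \<in> N \<rightarrow>\<^sub>M lborel_vec m"
  shows "(\<lambda>z. g z \<bullet> h z) \<in> borel_measurable N"
proof -
  have "(\<lambda>z. \<Sum>i<m. g z $ i * h z $ i) \<in> borel_measurable N"
    by (intro borel_measurable_sum borel_measurable_times
        measurable_compose[OF assms(1) measurable_vec_index] measurable_compose[OF assms(2) measurable_vec_index]) auto
  moreover have "(\<Sum>i<m. g z $ i * h z $ i) = g z \<bullet> h z" if "z \<in> space N" for z
    using measurable_space[OF assms(2) that] by (simp add: scalar_prod_def atLeast0LessThan)
  ultimately show ?thesis
    by (rule measurable_cong[THEN iffD1, rotated])
qed

text \<open>A nonzero determinant makes \<open>S\<close> a unit of the matrix ring, so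
  \<open>mat_inverse S\<close> is not \<open>None\<close> and \<open>the\<close> yields the true
  inverse.\<close>

lemma inv_mat:
  assumes "S \<in> carrier_mat m m" "Determinant.det S \<noteq> 0"
  shows "S * inv_mat S = 1\<^sub>m m" "inv_mat S * S = 1\<^sub>m m" "inv_mat S \<in> carrier_mat m m"
proof -
  have "S \<in> Units (ring_mat TYPE(real) m ())"
    using assms by (rule det_non_zero_imp_unit)
  then obtain B where B: "mat_inverse S = Some B"
    using mat_inverse(1)[OF assms(1), where b="()"] by (cases "mat_inverse S") auto
  from mat_inverse(2)[OF assms(1) B] B
  show "S * inv_mat S = 1\<^sub>m m" "inv_mat S * S = 1\<^sub>m m" "inv_mat S \<in> carrier_mat m m"
    by (auto simp: inv_mat_def)
qed

lemma borel_measurable_gauss_density: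
  assumes "\<mu> \<in> carrier_vec m" "S \<in> carrier_mat m m" "Determinant.det S \<noteq> 0"
  shows "gauss_density m \<mu> S \<in> borel_measurable (lborel_vec m)"
proof -
  have 1: "(\<lambda>z. z - \<mu>) \<in> lborel_vec m \<rightarrow>\<^sub>M lborel_vec m"
  proof (rule measurable_into_lborel_vec)
    fix i assume i: "i < m"
    have "(\<lambda>z. z $ i - \<mu> $ i) \<in> borel_measurable (lborel_vec m)"
      using i by (intro borel_measurable_diff measurable_vec_index) auto
    moreover have "z $ i - \<mu> $ i = (z - \<mu>) $ i" if "z \<in> space (lborel_vec m)" for z
      using that assms(1) i by simp
    ultimately show "(\<lambda>z. (z - \<mu>) $ i) \<in> borel_measurable (lborel_vec m)"
      by (rule measurable_cong[THEN iffD1, rotated])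
  qed (use assms in auto)
  have 2: "(\<lambda>z. inv_mat S *\<^sub>v (z - \<mu>)) \<in> lborel_vec m \<rightarrow>\<^sub>M lborel_vec m"
    using measurable_compose[OF 1 measurable_linear_vec[OF inv_mat(3)[OF assms(2,3)]]] .
  note [measurable] = borel_measurable_scalar_prod[OF 1 2]
  show ?thesis unfolding gauss_density_def[abs_def] by measurable
qed

lemma borel_measurable_quad:
  assumes "A \<in> carrier_mat m m" "a \<in> carrier_vec m"
  shows "quad A a a0 \<in> borel_measurable (lborel_vec m)"
proof -
  have id: "(\<lambda>z. z) \<in> lborel_vec m \<rightarrow>\<^sub>M lborel_vec m" by simp
  have const: "(\<lambda>z. a) \<in> lborel_vec m \<rightarrow>\<^sub>M lborel_vec m"
    using assms by simp
  note [measurable] = borel_measurable_scalar_prod[OF id measurable_linear_vec[OF assms(1)]]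
    borel_measurable_scalar_prod[OF const id]
  show ?thesis unfolding quad_def[abs_def] by measurable
qed

text \<open>The exponent reduces to the squared length of \<open>y\<close>, because the transpose of
  \<open>M\<close> times the inverse of the covariance times \<open>M\<close> is the identity: it is
  a one-sided inverse relation read from the other side. The root of the squared determinant leaves
  \<open>\<bar>det M\<bar>\<close>.\<close>

lemma gauss_density_affine:
  assumes M: "M \<in> carrier_mat m m" "Determinant.det M \<noteq> 0" and \<mu>: "\<mu> \<in> carrier_vec m"
  shows "gauss_density m \<mu> (M * transpose_mat M) (\<mu> + M *\<^sub>v Matrix.vec m y)
    = (\<Prod>i<m. std_normal_density (y i)) / \<bar>Determinant.det M\<bar>"
proof -
  let ?S = "M * transpose_mat M"
  let ?y = "Matrix.vec m y"
  have S: "?S \<in> carrier_mat m m" and tM: "transpose_mat M \<in> carrier_mat m m" using M by auto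
  have detS: "Determinant.det ?S = (Determinant.det M)\<^sup>2"
    using M by (simp add: det_mult[OF M(1) tM] det_transpose power2_eq_square)
  then have detS0: "Determinant.det ?S \<noteq> 0" using M by simp
  note inv = inv_mat[OF S detS0]
  have "M * (transpose_mat M * inv_mat ?S) = 1\<^sub>m m"
    using inv(1) unfolding assoc_mult_mat[OF M(1) tM inv(3)] .
  then have id: "transpose_mat M * inv_mat ?S * M = 1\<^sub>m m"
    by (rule mat_mult_left_right_inverse[OF M(1) mult_carrier_mat[OF tM inv(3)]])
  have y: "?y \<in> carrier_vec m" by simp
  have My: "M *\<^sub>v ?y \<in> carrier_vec m" using M by simp
  have "\<mu> + v - \<mu> = v" if "v \<in> carrier_vec m" for v
    using \<mu> that by (intro eq_vecI) auto
  from this[OF My] have "\<mu> + M *\<^sub>v ?y - \<mu> = M *\<^sub>v ?y" .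
  moreover have "(M *\<^sub>v ?y) \<bullet> (inv_mat ?S *\<^sub>v (M *\<^sub>v ?y)) = (\<Sum>i<m. (y i)\<^sup>2)"
  proof -
    have z: "inv_mat ?S *\<^sub>v (M *\<^sub>v ?y) \<in> carrier_vec m" using inv(3) My by simp
    have "(M *\<^sub>v ?y) \<bullet> (inv_mat ?S *\<^sub>v (M *\<^sub>v ?y)) = (inv_mat ?S *\<^sub>v (M *\<^sub>v ?y)) \<bullet> (M *\<^sub>v ?y)"
      using comm_scalar_prod[OF My z] .
    also have "\<dots> = (transpose_mat M *\<^sub>v (inv_mat ?S *\<^sub>v (M *\<^sub>v ?y))) \<bullet> ?y"
      using transpose_vec_mult_scalar[OF M(1) y z] by simp
    also have "transpose_mat M *\<^sub>v (inv_mat ?S *\<^sub>v (M *\<^sub>v ?y)) = (transpose_mat M * inv_mat ?S * M) *\<^sub>v ?y"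
      unfolding assoc_mult_mat_vec[OF mult_carrier_mat[OF tM inv(3)] M(1) y]
        assoc_mult_mat_vec[OF tM inv(3) My] ..
    also have "\<dots> \<bullet> ?y = (\<Sum>i<m. (y i)\<^sup>2)"
      unfolding id by (simp add: scalar_prod_def atLeast0LessThan power2_eq_square)
    finally show ?thesis .
  qed
  moreover have "(\<Prod>i<m. std_normal_density (y i)) = exp (- (1/2) * (\<Sum>i<m. (y i)\<^sup>2)) / sqrt (2 * pi) ^ m"
    unfolding std_normal_density_def
    by (simp add: prod_dividef exp_sum[symmetric] sum_distrib_left sum_negf sum_divide_distrib power_one_over)
  moreover have "sqrt ((2 * pi) ^ m * (Determinant.det M)\<^sup>2) = sqrt (2 * pi) ^ m * \<bar>Determinant.det M\<bar>"
    by (simp only: real_sqrt_mult[of "(2 * pi) ^ m"] real_sqrt_power[of "2 * pi"] real_sqrt_abs)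
  ultimately show ?thesis
    by (simp only: gauss_density_def detS divide_divide_eq_left)
qed

text \<open>The Jacobian of the affine substitution cancels the determinant in the density. Any
  invertible factor \<open>M\<close> of the covariance is allowed, symmetric or not, so that it can
  be chosen to diagonalise the quadratic form as well.\<close>

lemma law_gauss_density:
  assumes M: "M \<in> carrier_mat m m" "Determinant.det M \<noteq> 0" and \<mu>: "\<mu> \<in> carrier_vec m"
  shows "law m (gauss_density m \<mu> (M * transpose_mat M))
    = distr (std_normal_PiM m) (lborel_vec m) (\<lambda>y. \<mu> + M *\<^sub>v Matrix.vec m y)"
proof (rule measure_eqI)
  let ?S = "M * transpose_mat M"
  let ?P = "\<Pi>\<^sub>M i\<in>{..<m}. (lborel :: real measure)"
  let ?d = "\<lambda>x. \<Prod>i<m. ennreal (std_normal_density (x i))"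
  let ?T = "\<lambda>y. \<mu> + M *\<^sub>v Matrix.vec m y"
  have S: "?S \<in> carrier_mat m m" using M by auto
  have "Determinant.det ?S = (Determinant.det M)\<^sup>2"
    using M by (subst det_mult[OF M(1)]) (auto simp: det_transpose power2_eq_square)
  then have detS: "Determinant.det ?S \<noteq> 0" using M by simp
  note [measurable] = borel_measurable_gauss_density[OF \<mu> S detS]
  show "sets (law m (gauss_density m \<mu> ?S)) = sets (distr (std_normal_PiM m) (lborel_vec m) ?T)"
    by (simp add: law_def)
  fix B assume "B \<in> sets (law m (gauss_density m \<mu> ?S))"
  then have B [measurable]: "B \<in> sets (lborel_vec m)" by (simp add: law_def)
  have T: "?T \<in> ?P \<rightarrow>\<^sub>M lborel_vec m"
    using measurable_compose[OF measurable_vec measurable_affine_vec[OF M(1) \<mu>]] .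
  note [measurable] = T
  have "emeasure (law m (gauss_density m \<mu> ?S)) B
      = (\<integral>\<^sup>+z. ennreal (gauss_density m \<mu> ?S z) * indicator B z \<partial>lborel_vec m)"
    unfolding law_def by (rule emeasure_density) auto
  also have "\<dots> = ennreal \<bar>Determinant.det M\<bar> *
      (\<integral>\<^sup>+z. ennreal (gauss_density m \<mu> ?S (\<mu> + M *\<^sub>v z)) * indicator B (\<mu> + M *\<^sub>v z) \<partial>lborel_vec m)"
    by (rule nn_integral_lborel_vec_affine[OF M \<mu>, symmetric]) measurable
  also have "\<dots> = ennreal \<bar>Determinant.det M\<bar> *
      (\<integral>\<^sup>+y. ennreal (gauss_density m \<mu> ?S (?T y)) * indicator B (?T y) \<partial>?P)"
    by (subst nn_integral_lborel_vec, rule measurable_compose[OF measurable_affine_vec[OF M(1) \<mu>]]) auto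
  also have "\<dots> = (\<integral>\<^sup>+y. ennreal \<bar>Determinant.det M\<bar> * (ennreal (gauss_density m \<mu> ?S (?T y)) * indicator B (?T y)) \<partial>?P)"
    by (rule nn_integral_cmult[symmetric]) measurable
  also have "\<dots> = (\<integral>\<^sup>+y. ?d y * indicator (?T -` B \<inter> space ?P) y \<partial>?P)"
  proof (rule nn_integral_cong)
    fix y assume y: "y \<in> space ?P"
    have "ennreal \<bar>Determinant.det M\<bar> * ennreal (gauss_density m \<mu> ?S (?T y)) = ennreal (\<Prod>i<m. std_normal_density (y i))"
      unfolding gauss_density_affine[OF M \<mu>] using M by (simp add: ennreal_mult'[symmetric])
    also have "\<dots> = ?d y" by (simp add: prod_ennreal)
    finally have "ennreal \<bar>Determinant.det M\<bar> * ennreal (gauss_density m \<mu> ?S (?T y)) = ?d y" .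
    then show "ennreal \<bar>Determinant.det M\<bar> * (ennreal (gauss_density m \<mu> ?S (?T y)) * indicator B (?T y))
        = ?d y * indicator (?T -` B \<inter> space ?P) y"
      using y by (simp add: mult.assoc[symmetric] indicator_def)
  qed
  also have "\<dots> = emeasure (density ?P ?d) (?T -` B \<inter> space ?P)"
    by (rule emeasure_density[symmetric]) measurable
  also have "\<dots> = emeasure (distr (std_normal_PiM m) (lborel_vec m) ?T) B"
    unfolding PiM_std_normal_distribution using T by (subst emeasure_distr) auto
  finally show "emeasure (law m (gauss_density m \<mu> ?S)) B = emeasure (distr (std_normal_PiM m) (lborel_vec m) ?T) B" .
qed

section \<open>Quadratic functions of Gaussian vectors and mixtures\<close>

lemma det_pos_def_mat:
  assumes "pos_def_mat m S"
  shows "Determinant.det S \<noteq> 0"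
proof
  have S: "S \<in> carrier_mat m m" using assms by (simp add: pos_def_mat_def)
  assume "Determinant.det S = 0"
  then obtain v where v: "v \<in> carrier_vec m" "v \<noteq> 0\<^sub>v m" "S *\<^sub>v v = 0\<^sub>v m"
    using det_0_iff_vec_prod_zero[OF S] by auto
  then have "0 < v \<bullet> (S *\<^sub>v v)" using assms by (auto simp: pos_def_mat_def)
  then show False using v by simp
qed

text \<open>With the mean also written as \<open>M *\<^sub>v d\<close>, the argument is
  \<open>M\<close> applied to \<open>d + y\<close>; congruence by \<open>M\<close> diagonalises
  \<open>A\<close>, and the polynomial separates into coordinates.\<close>

lemma quad_affine:
  assumes M: "M \<in> carrier_mat m m" and A: "A \<in> carrier_mat m m"
    and diag: "transpose_mat M * A * M = mat_diag m l"
    and a: "a \<in> carrier_vec m" and d: "d \<in> carrier_vec m"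
  shows "quad A a a0 (M *\<^sub>v d + M *\<^sub>v Matrix.vec m y)
    = a0 + (\<Sum>j<m. l j / 2 * (y j + d $ j)\<^sup>2 + (transpose_mat M *\<^sub>v a) $ j * (y j + d $ j))"
proof -
  define x where "x = d + Matrix.vec m y"
  have x: "x \<in> carrier_vec m" using d by (simp add: x_def)
  have tM: "transpose_mat M \<in> carrier_mat m m" using M by simp
  have Mx: "M *\<^sub>v x \<in> carrier_vec m" and AMx: "A *\<^sub>v (M *\<^sub>v x) \<in> carrier_vec m"
    using M A x by auto
  have xj: "x $ j = y j + d $ j" if "j < m" for j
    using that d by (simp add: x_def)
  have "M *\<^sub>v d + M *\<^sub>v Matrix.vec m y = M *\<^sub>v x"
    unfolding x_def using mult_add_distrib_mat_vec[OF M d vec_carrier] by simp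
  moreover have "(M *\<^sub>v x) \<bullet> (A *\<^sub>v (M *\<^sub>v x)) = (\<Sum>j<m. l j * (y j + d $ j)\<^sup>2)"
  proof -
    have "(M *\<^sub>v x) \<bullet> (A *\<^sub>v (M *\<^sub>v x)) = (transpose_mat M *\<^sub>v (A *\<^sub>v (M *\<^sub>v x))) \<bullet> x"
      using comm_scalar_prod[OF Mx AMx] transpose_vec_mult_scalar[OF M x AMx] by simp
    also have "transpose_mat M *\<^sub>v (A *\<^sub>v (M *\<^sub>v x)) = (transpose_mat M * A * M) *\<^sub>v x"
      unfolding assoc_mult_mat_vec[OF mult_carrier_mat[OF tM A] M x] assoc_mult_mat_vec[OF tM A Mx] ..
    also have "\<dots> = Matrix.vec m (\<lambda>j. l j * x $ j)"
    proof (rule eq_vecI)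
      fix i assume "i < dim_vec (Matrix.vec m (\<lambda>j. l j * x $ j))"
      then have i: "i < m" by simp
      then have "((transpose_mat M * A * M) *\<^sub>v x) $ i = (\<Sum>j<m. (if i = j then l j else 0) * x $ j)"
        unfolding diag using x by (simp add: mat_diag_def scalar_prod_def atLeast0LessThan)
      also have "\<dots> = (\<Sum>j<m. if i = j then l j * x $ j else 0)"
        by (intro sum.cong) auto
      finally show "((transpose_mat M * A * M) *\<^sub>v x) $ i = Matrix.vec m (\<lambda>j. l j * x $ j) $ i"
        using i by simp
    qed (simp add: diag mat_diag_def)
    also have "\<dots> \<bullet> x = (\<Sum>j<m. l j * (y j + d $ j)\<^sup>2)"
      using x by (simp add: scalar_prod_def atLeast0LessThan xj power2_eq_square mult.assoc)
    finally show ?thesis .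
  qed
  moreover have "a \<bullet> (M *\<^sub>v x) = (\<Sum>j<m. (transpose_mat M *\<^sub>v a) $ j * (y j + d $ j))"
  proof -
    have "a \<bullet> (M *\<^sub>v x) = (transpose_mat M *\<^sub>v a) \<bullet> x"
      using transpose_vec_mult_scalar[OF M x a] by simp
    also have "\<dots> = (\<Sum>j<m. (transpose_mat M *\<^sub>v a) $ j * x $ j)"
      using x by (simp only: scalar_prod_def atLeast0LessThan carrier_vecD)
    also have "\<dots> = (\<Sum>j<m. (transpose_mat M *\<^sub>v a) $ j * (y j + d $ j))"
      by (intro sum.cong) (simp_all only: xj lessThan_iff)
    finally show ?thesis .
  qed
  ultimately show ?thesis
    by (simp only: quad_def sum.distrib sum_distrib_left) (simp add: sum_divide_distrib sum_distrib_left[symmetric])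
qed

text \<open>Expanding each coordinate around its mean gives a centred quadratic whose linear
  coefficient is \<open>\<beta> j\<close>. Written without division, it also covers coordinates with
  \<open>l j = 0\<close>.\<close>

lemma quad_gauss:
  fixes l :: "nat \<Rightarrow> real" and a0 :: real
  assumes M: "M \<in> carrier_mat m m" "Determinant.det M \<noteq> 0" and A: "A \<in> carrier_mat m m"
    and diag: "transpose_mat M * A * M = mat_diag m l"
    and a: "a \<in> carrier_vec m" and d: "d \<in> carrier_vec m"
  defines "p \<equiv> gauss_density m (M *\<^sub>v d) (M * transpose_mat M)"
    and "c \<equiv> quad A a a0"
    and "\<beta> \<equiv> \<lambda>j. l j * d $ j + (transpose_mat M *\<^sub>v a) $ j"
  shows prob_space_law_gauss: "prob_space (law m p)"
    and integrable_quad_gauss: "integrable (law m p) c"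
    and integrable_quad_square_gauss: "integrable (law m p) (\<lambda>z. (c z)\<^sup>2)"
    and var_quad_gauss: "var_under m p c = (\<Sum>j<m. (l j)\<^sup>2 / 2 + (\<beta> j)\<^sup>2)"
    and char_quad_gauss_bound:
      "cmod (mean_under m p (\<lambda>z. iexp (u * c z))
          - exp (\<i> * complex_of_real (u * mean_under m p c) - complex_of_real (u\<^sup>2 * var_under m p c / 2)))
        \<le> 3/2 * \<bar>u\<bar> ^ 3 * (\<Sum>j<m. \<bar>l j\<bar> * ((l j)\<^sup>2 / 2 + (\<beta> j)\<^sup>2))"
proof -
  interpret N: real_distribution std_normal_distribution
    by (rule real_dist_normal_dist)
  let ?P = "std_normal_PiM m"
  interpret P: prob_space ?P
    by (rule prob_space_PiM) (rule N.prob_space_axioms)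
  define T where "T y = M *\<^sub>v d + M *\<^sub>v Matrix.vec m y" for y
  have \<mu>: "M *\<^sub>v d \<in> carrier_vec m" using M d by simp
  have law: "law m p = distr ?P (lborel_vec m) T"
    unfolding p_def T_def by (rule law_gauss_density[OF M \<mu>])
  have vec: "Matrix.vec m \<in> ?P \<rightarrow>\<^sub>M lborel_vec m"
  proof -
    have "Matrix.vec m \<in> (\<Pi>\<^sub>M i\<in>{..<m}. lborel) \<rightarrow>\<^sub>M lborel_vec m" by (rule measurable_vec)
    also have "(\<Pi>\<^sub>M i\<in>{..<m}. lborel) \<rightarrow>\<^sub>M lborel_vec m = ?P \<rightarrow>\<^sub>M lborel_vec m"
      by (intro measurable_cong_sets sets_PiM_cong) auto
    finally show ?thesis .
  qed
  have T: "T \<in> ?P \<rightarrow>\<^sub>M lborel_vec m"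
    unfolding T_def using measurable_compose[OF vec measurable_affine_vec[OF M(1) \<mu>]] .
  have c: "c \<in> borel_measurable (lborel_vec m)"
    unfolding c_def using A a by (rule borel_measurable_quad)
  note [measurable] = T c
  show "prob_space (law m p)"
    unfolding law using T by (rule P.prob_space_distr)
  define X where "X j = centered_quadratic (l j) (\<beta> j)" for j
  \<comment> \<open>The mean of the polynomial: each square of a standard normal coordinate
    contributes 1.\<close>
  define \<kappa> where "\<kappa> = a0 + (\<Sum>j<m. l j / 2 * (1 + (d $ j)\<^sup>2) + (transpose_mat M *\<^sub>v a) $ j * d $ j)"
  have cT: "c (T y) = \<kappa> + (\<Sum>j<m. X j (y j))" for y
  proof -
    let ?b = "transpose_mat M *\<^sub>v a"
    have "(\<Sum>j<m. l j / 2 * (y j + d $ j)\<^sup>2 + ?b $ j * (y j + d $ j))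
        = (\<Sum>j<m. (l j / 2 * (1 + (d $ j)\<^sup>2) + ?b $ j * d $ j) + X j (y j))"
      by (intro sum.cong refl)
         (simp add: X_def \<beta>_def centered_quadratic_def field_simps power2_eq_square del: index_mult_mat_vec)
    then show ?thesis
      unfolding c_def T_def quad_affine[OF M(1) A diag a d] \<kappa>_def by (simp only: sum.distrib add.assoc)
  qed
  have Xm: "integrable std_normal_distribution (X j)" "(\<integral>x. X j x \<partial>std_normal_distribution) = 0"
      "integrable std_normal_distribution (\<lambda>x. (X j x)\<^sup>2)"
      "(\<integral>x. (X j x)\<^sup>2 \<partial>std_normal_distribution) = (l j)\<^sup>2 / 2 + (\<beta> j)\<^sup>2" for j
    using centered_quadratic_std_normal_moments[of "l j" "\<beta> j"]
    unfolding X_def has_bochner_integral_iff by auto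
  have S1: "has_bochner_integral ?P (\<lambda>y. \<Sum>j<m. X j (y j)) 0"
    and S2: "has_bochner_integral ?P (\<lambda>y. (\<Sum>j<m. X j (y j))\<^sup>2) (\<Sum>j<m. (l j)\<^sup>2 / 2 + (\<beta> j)\<^sup>2)"
    using product_centered_sum[of "\<lambda>_. std_normal_distribution" "{..<m}" X] Xm N.prob_space_axioms by simp_all
  note S = S1[unfolded has_bochner_integral_iff] S2[unfolded has_bochner_integral_iff]
  show int1: "integrable (law m p) c"
    unfolding law using S by (subst integrable_distr_eq) (auto simp: cT)
  have "integrable ?P (\<lambda>y. (\<Sum>j<m. X j (y j))\<^sup>2 + 2 * \<kappa> * (\<Sum>j<m. X j (y j)) + \<kappa>\<^sup>2)"
    using S by (intro Bochner_Integration.integrable_add integrable_mult_right) auto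
  also have "(\<lambda>y. (\<Sum>j<m. X j (y j))\<^sup>2 + 2 * \<kappa> * (\<Sum>j<m. X j (y j)) + \<kappa>\<^sup>2) = (\<lambda>y. (c (T y))\<^sup>2)"
    by (simp add: cT power2_sum algebra_simps)
  finally show "integrable (law m p) (\<lambda>z. (c z)\<^sup>2)"
    unfolding law by (subst integrable_distr_eq) auto
  have mean: "mean_under m p c = \<kappa>"
    unfolding mean_under_def law using S P.prob_space by (subst integral_distr) (auto simp: cT)
  show var: "var_under m p c = (\<Sum>j<m. (l j)\<^sup>2 / 2 + (\<beta> j)\<^sup>2)"
    unfolding var_under_def mean unfolding mean_under_def law
    using S by (subst integral_distr) (auto simp: cT)
  define V where "V = (\<Sum>j<m. (l j)\<^sup>2 / 2 + (\<beta> j)\<^sup>2)"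
  have "mean_under m p (\<lambda>z. iexp (u * c z)) = (\<integral>y. iexp (u * c (T y)) \<partial>?P)"
    unfolding mean_under_def law by (subst integral_distr) auto
  also have "\<dots> = (\<integral>y. iexp (u * \<kappa>) * iexp (u * (\<Sum>j<m. X j (y j))) \<partial>?P)"
    by (simp add: cT algebra_simps exp_add)
  also have "\<dots> = iexp (u * \<kappa>) * (\<integral>y. iexp (u * (\<Sum>j<m. X j (y j))) \<partial>?P)"
    by (rule integral_mult_right_zero)
  moreover have split: "exp (\<i> * complex_of_real (u * \<kappa>) - complex_of_real (u\<^sup>2 * V / 2))
      = iexp (u * \<kappa>) * complex_of_real (exp (- (u\<^sup>2 * V / 2)))"
    by (simp only: exp_of_real[symmetric] of_real_minus exp_add[symmetric] diff_conv_add_uminus)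
  ultimately have "mean_under m p (\<lambda>z. iexp (u * c z))
        - exp (\<i> * complex_of_real (u * mean_under m p c) - complex_of_real (u\<^sup>2 * var_under m p c / 2))
      = iexp (u * \<kappa>) * ((\<integral>y. iexp (u * (\<Sum>j<m. X j (y j))) \<partial>?P) - exp (- (u\<^sup>2 * V / 2)))"
    unfolding mean var V_def[symmetric] split right_diff_distrib by (simp only:)
  \<comment> \<open>The mean only contributes a phase of modulus 1, common to both terms.\<close>
  then have "cmod (mean_under m p (\<lambda>z. iexp (u * c z))
        - exp (\<i> * complex_of_real (u * mean_under m p c) - complex_of_real (u\<^sup>2 * var_under m p c / 2)))
      = cmod ((\<integral>y. iexp (u * (\<Sum>j<m. X j (y j))) \<partial>?P) - exp (- (u\<^sup>2 * V / 2)))"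
    by (simp only: norm_mult norm_exp_i_times mult_1_left)
  also have "\<dots> \<le> 3/2 * \<bar>u\<bar> ^ 3 * (\<Sum>j<m. \<bar>l j\<bar> * ((l j)\<^sup>2 / 2 + (\<beta> j)\<^sup>2))"
    unfolding V_def X_def by (rule char_sum_centered_quadratic_bound)
  finally show "cmod (mean_under m p (\<lambda>z. iexp (u * c z))
          - exp (\<i> * complex_of_real (u * mean_under m p c) - complex_of_real (u\<^sup>2 * var_under m p c / 2)))
        \<le> 3/2 * \<bar>u\<bar> ^ 3 * (\<Sum>j<m. \<bar>l j\<bar> * ((l j)\<^sup>2 / 2 + (\<beta> j)\<^sup>2))" .
qed

section \<open>Mixtures and the passage to the limit\<close>

lemma mean_under_mixture:
  fixes f :: "real vec \<Rightarrow> 'b::{banach, second_countable_topology}"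
  assumes w: "\<And>i. i \<in> {1..K} \<Longrightarrow> w i \<ge> 0"
    and p: "\<And>i. i \<in> {1..K} \<Longrightarrow> gauss_density m (\<mu> i) (S i) \<in> borel_measurable (lborel_vec m)"
    and p0: "\<And>i z. i \<in> {1..K} \<Longrightarrow> gauss_density m (\<mu> i) (S i) z \<ge> 0"
    and f: "f \<in> borel_measurable (lborel_vec m)"
    and int: "\<And>i. i \<in> {1..K} \<Longrightarrow> integrable (law m (gauss_density m (\<mu> i) (S i))) f"
  shows "mean_under m (mixture_density m K w \<mu> S) f
    = (\<Sum>i=1..K. w i *\<^sub>R mean_under m (gauss_density m (\<mu> i) (S i)) f)"
proof -
  let ?p = "\<lambda>i. gauss_density m (\<mu> i) (S i)"
  have mix: "mixture_density m K w \<mu> S \<in> borel_measurable (lborel_vec m)"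
    unfolding mixture_density_def[abs_def] using p by (intro borel_measurable_sum borel_measurable_times) auto
  have int': "integrable (lborel_vec m) (\<lambda>z. ?p i z *\<^sub>R f z)" if "i \<in> {1..K}" for i
    using int[OF that] unfolding law_def
    by (subst (asm) integrable_density) (use p[OF that] p0[OF that] f in auto)
  have eq: "mean_under m (?p i) f = (\<integral>z. ?p i z *\<^sub>R f z \<partial>lborel_vec m)" if "i \<in> {1..K}" for i
    unfolding mean_under_def law_def
    by (subst integral_density) (use p[OF that] p0[OF that] f in auto)
  have "mean_under m (mixture_density m K w \<mu> S) f = (\<integral>z. mixture_density m K w \<mu> S z *\<^sub>R f z \<partial>lborel_vec m)"
    unfolding mean_under_def law_def
    by (subst integral_density) (use mix f w p0 in \<open>auto simp: mixture_density_def intro!: sum_nonneg mult_nonneg_nonneg\<close>)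
  also have "\<dots> = (\<integral>z. (\<Sum>i=1..K. w i *\<^sub>R (?p i z *\<^sub>R f z)) \<partial>lborel_vec m)"
    by (simp add: mixture_density_def scaleR_sum_left)
  also have "\<dots> = (\<Sum>i=1..K. w i *\<^sub>R (\<integral>z. ?p i z *\<^sub>R f z \<partial>lborel_vec m))"
    using int' by (subst Bochner_Integration.integral_sum)
      (auto simp only: integral_scaleR_right intro!: integrable_scaleR_right)
  finally show ?thesis
    by (simp add: eq)
qed

text \<open>The mean minimises the mean squared deviation; the excess is the square of its distance
  from \<open>x\<close>. For a mixture component, \<open>x\<close> will be the mean of the whole
  mixture.\<close>

lemma var_under_le:
  assumes "prob_space (law m p)" "integrable (law m p) c" "integrable (law m p) (\<lambda>z. (c z)\<^sup>2)"
  shows "var_under m p c \<le> mean_under m p (\<lambda>z. (c z - x)\<^sup>2)"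
proof -
  interpret prob_space "law m p" by fact
  let ?E = "mean_under m p c"
  have *: "mean_under m p (\<lambda>z. (c z - y)\<^sup>2) = mean_under m p (\<lambda>z. (c z)\<^sup>2) - 2 * y * ?E + y\<^sup>2" for y
  proof -
    have "mean_under m p (\<lambda>z. (c z - y)\<^sup>2) = (\<integral>z. (c z)\<^sup>2 - 2 * y * c z + y\<^sup>2 \<partial>law m p)"
      unfolding mean_under_def by (intro Bochner_Integration.integral_cong) (auto simp: power2_diff algebra_simps)
    then show ?thesis
      using assms(2,3) prob_space by (simp add: mean_under_def)
  qed
  have "mean_under m p (\<lambda>z. (c z - x)\<^sup>2) - var_under m p c = (x - ?E)\<^sup>2"
    unfolding var_under_def * by (simp add: power2_eq_square algebra_simps)
  then show ?thesis
    using zero_le_power2[of "x - ?E"] by linarith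
qed

text \<open>In the constant, 3/2 comes from a single coordinate, \<open>sqrt 2\<close> from
  \<open>1/2 + (\<delta> j)\<^sup>2 \<le> 2 * (1/4 + (\<delta> j)\<^sup>2)\<close>, and the power of
  \<open>sqrt w\<close> from the lower bound on \<open>\<sigma>\<close>. Coordinates beyond
  \<open>h\<close> have \<open>l j = 0\<close>: they vanish from the cubic sum and add only
  nonnegative terms to the variance.\<close>

lemma quadratic_error_le_fourth_order_ratio:
  fixes l \<beta> \<delta> :: "nat \<Rightarrow> real"
  assumes h: "0 < h" "h \<le> m" and l: "\<And>j. j < m \<Longrightarrow> l j \<noteq> 0 \<longleftrightarrow> j < h"
    and \<beta>: "\<And>j. j < h \<Longrightarrow> \<beta> j = l j * \<delta> j"
    and w: "w > 0" and \<sigma>: "\<sigma>\<^sup>2 \<ge> w * (\<Sum>j<m. (l j)\<^sup>2 / 2 + (\<beta> j)\<^sup>2)" "\<sigma> \<ge> 0"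
  shows "3/2 * \<bar>t / \<sigma>\<bar> ^ 3 * (\<Sum>j<m. \<bar>l j\<bar> * ((l j)\<^sup>2 / 2 + (\<beta> j)\<^sup>2))
    \<le> (3/2 * sqrt 2 * \<bar>t\<bar> ^ 3 / sqrt w ^ 3) *
        (root 4 (\<Sum>j<h. (1 / 4 + (\<delta> j)\<^sup>2) * l j ^ 4) / sqrt (\<Sum>j<h. (1 / 2 + (\<delta> j)\<^sup>2) * (l j)\<^sup>2))\<^sup>2"
proof -
  define q where "q j = 1/2 + (\<delta> j)\<^sup>2" for j
  define S2 where "S2 = (\<Sum>j<h. q j * (l j)\<^sup>2)"
  define S4 where "S4 = (\<Sum>j<h. (1 / 4 + (\<delta> j)\<^sup>2) * l j ^ 4)"
  have q0: "q j > 0" for j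
    unfolding q_def by (simp add: add_pos_nonneg)
  \<comment> \<open>Coordinate 0 has \<open>l 0 \<noteq> 0\<close> since \<open>h > 0\<close>, so
    all divisions below are genuine.\<close>
  have S2: "S2 > 0"
    unfolding S2_def using h l[of 0] q0
    by (intro sum_pos2[of _ 0]) (auto simp: less_imp_le)
  have S4: "S4 \<ge> 0"
    unfolding S4_def by (intro sum_nonneg mult_nonneg_nonneg) auto
  have lq: "(l j)\<^sup>2 / 2 + (\<beta> j)\<^sup>2 = q j * (l j)\<^sup>2" if "j < h" for j
    unfolding \<beta>[OF that] q_def by (simp add: algebra_simps power_mult_distrib)
  have "S2 = (\<Sum>j<h. (l j)\<^sup>2 / 2 + (\<beta> j)\<^sup>2)"
    unfolding S2_def by (intro sum.cong) (auto simp: lq)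
  also have "\<dots> \<le> (\<Sum>j<m. (l j)\<^sup>2 / 2 + (\<beta> j)\<^sup>2)"
    using h by (intro sum_mono2) auto
  finally have "w * S2 \<le> \<sigma>\<^sup>2"
    using \<sigma>(1) w by (meson mult_left_mono less_imp_le order_trans)
  then have "sqrt (w * S2) \<le> \<sigma>"
    using \<sigma>(2) by (rule real_le_lsqrt[rotated])
  then have \<sigma>_ge: "sqrt w * sqrt S2 \<le> \<sigma>" by (simp add: real_sqrt_mult)
  have pos: "sqrt w * sqrt S2 > 0" using w S2 by simp
  have "(\<Sum>j<m. \<bar>l j\<bar> * ((l j)\<^sup>2 / 2 + (\<beta> j)\<^sup>2)) = (\<Sum>j<h. \<bar>l j\<bar> * ((l j)\<^sup>2 / 2 + (\<beta> j)\<^sup>2))"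
  proof (rule sum.mono_neutral_right)
    have "l j = 0" if "h \<le> j" "j < m" for j using l[of j] that by auto
    then show "\<forall>j\<in>{..<m} - {..<h}. \<bar>l j\<bar> * ((l j)\<^sup>2 / 2 + (\<beta> j)\<^sup>2) = 0" by auto
  qed (use h in auto)
  \<comment> \<open>The weight is split evenly and the cube as 1 + 2, so that Cauchy--Schwarz yields
    the sums of second and fourth powers.\<close>
  also have "\<dots> = (\<Sum>j<h. (sqrt (q j) * \<bar>l j\<bar>) * (sqrt (q j) * (l j)\<^sup>2))"
    using q0 by (intro sum.cong) (auto simp: lq less_imp_le mult_ac simp flip: real_sqrt_mult)
  also have "\<dots> \<le> sqrt ((\<Sum>j<h. (sqrt (q j) * \<bar>l j\<bar>)\<^sup>2) * (\<Sum>j<h. (sqrt (q j) * (l j)\<^sup>2)\<^sup>2))"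
    by (rule real_le_rsqrt[OF Cauchy_Schwarz_ineq_sum])
  also have "\<dots> = sqrt (S2 * (\<Sum>j<h. q j * l j ^ 4))"
    using q0 by (simp add: S2_def power_mult_distrib less_imp_le flip: power_mult)
  also have "\<dots> \<le> sqrt (S2 * (2 * S4))"
    unfolding S4_def sum_distrib_left q_def using S2
    by (intro real_sqrt_le_mono mult_left_mono sum_mono) (auto simp: mult.assoc[symmetric] intro!: mult_right_mono)
  also have "\<dots> = sqrt 2 * sqrt S2 * sqrt S4"
    by (simp add: real_sqrt_mult)
  finally have L3: "(\<Sum>j<m. \<bar>l j\<bar> * ((l j)\<^sup>2 / 2 + (\<beta> j)\<^sup>2)) \<le> sqrt 2 * sqrt S2 * sqrt S4" .
  have "\<bar>t / \<sigma>\<bar> \<le> \<bar>t\<bar> / (sqrt w * sqrt S2)"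
    using \<sigma>_ge pos \<sigma>(2) by (auto simp: abs_divide intro!: divide_left_mono mult_pos_pos)
  then have "\<bar>t / \<sigma>\<bar> ^ 3 \<le> (\<bar>t\<bar> / (sqrt w * sqrt S2)) ^ 3"
    by (rule power_mono) simp
  then have "3/2 * \<bar>t / \<sigma>\<bar> ^ 3 * (\<Sum>j<m. \<bar>l j\<bar> * ((l j)\<^sup>2 / 2 + (\<beta> j)\<^sup>2))
      \<le> 3/2 * (\<bar>t\<bar> / (sqrt w * sqrt S2)) ^ 3 * (sqrt 2 * sqrt S2 * sqrt S4)"
    using w S2 by (intro mult_mono L3) (auto intro!: sum_nonneg mult_nonneg_nonneg)
  also have "\<dots> = (3/2 * sqrt 2 * \<bar>t\<bar> ^ 3 / sqrt w ^ 3) * (sqrt S4 / (sqrt S2)\<^sup>2)"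
    using w S2 by (simp add: field_simps power2_eq_square power3_eq_cube)
  also have "sqrt S4 / (sqrt S2)\<^sup>2 = (root 4 S4 / sqrt S2)\<^sup>2"
    using S4 real_root_mult_exp[of 2 2 S4] by (simp add: power_divide flip: sqrt_def)
  finally show ?thesis
    unfolding S2_def S4_def q_def .
qed

theorem theorem1:
  fixes K :: nat and w :: "nat \<Rightarrow> real"
    and \<mu> :: "nat \<Rightarrow> nat \<Rightarrow> real vec" and \<Sigma> :: "nat \<Rightarrow> nat \<Rightarrow> real mat"
    and A :: "nat \<Rightarrow> real mat" and a :: "nat \<Rightarrow> real vec" and a0 :: "nat \<Rightarrow> real"
    and R D :: "nat \<Rightarrow> nat \<Rightarrow> real mat"
    and l :: "nat \<Rightarrow> nat \<Rightarrow> nat \<Rightarrow> real" and h :: "nat \<Rightarrow> nat \<Rightarrow> nat"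
    and t :: real
  defines "c \<equiv> \<lambda>m. quad (A m) (a m) (a0 m)"
    and "p \<equiv> \<lambda>m i. gauss_density m (\<mu> m i) (\<Sigma> m i)"
    and "pmix \<equiv> \<lambda>m. mixture_density m K w (\<mu> m) (\<Sigma> m)"
    and "\<delta> \<equiv> \<lambda>m i. shift_coeff (R m i) (D m i) (l m i) (\<mu> m i) (a m)"
  defines "\<sigma> \<equiv> \<lambda>m. sqrt (var_under m (pmix m) (c m))"
  assumes "K \<ge> 1"
    and "\<And>i. i \<in> {1..K} \<Longrightarrow> w i > 0"
    and "(\<Sum>i=1..K. w i) = 1"
    and "\<And>m. m \<ge> 1 \<Longrightarrow> A m \<in> carrier_mat m m \<and> transpose_mat (A m) = A m"
    and "\<And>m. m \<ge> 1 \<Longrightarrow> a m \<in> carrier_vec m"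
    and "\<And>m i. m \<ge> 1 \<Longrightarrow> i \<in> {1..K} \<Longrightarrow> \<mu> m i \<in> carrier_vec m"
    and "\<And>m i. m \<ge> 1 \<Longrightarrow> i \<in> {1..K} \<Longrightarrow> pos_def_mat m (\<Sigma> m i)"
    and "\<And>m i. m \<ge> 1 \<Longrightarrow> i \<in> {1..K} \<Longrightarrow> pos_def_mat m (R m i) \<and> R m i * R m i = \<Sigma> m i"
    and "\<And>m i. m \<ge> 1 \<Longrightarrow> i \<in> {1..K} \<Longrightarrow> orthonormal_mat m (D m i)"
    and "\<And>m i. m \<ge> 1 \<Longrightarrow> i \<in> {1..K} \<Longrightarrow>
           R m i * A m * R m i = D m i * mat_diag m (l m i) * transpose_mat (D m i)"
    and "\<And>m i. m \<ge> 1 \<Longrightarrow> i \<in> {1..K} \<Longrightarrow> 0 < h m i \<and> h m i \<le> m"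
    and "\<And>m i j. m \<ge> 1 \<Longrightarrow> i \<in> {1..K} \<Longrightarrow> j < m \<Longrightarrow> l m i j \<noteq> 0 \<longleftrightarrow> j < h m i"
    and "\<And>i. i \<in> {1..K} \<Longrightarrow> filterlim (\<lambda>m. h m i) at_top sequentially"
    and "\<And>i. i \<in> {1..K} \<Longrightarrow>
           uniform_limit {3..}
             (\<lambda>m k. root k (\<Sum>j<h m i. (1 / real k + (\<delta> m i j)\<^sup>2) * l m i j ^ k) /
                    sqrt (\<Sum>j<h m i. (1 / 2 + (\<delta> m i j)\<^sup>2) * (l m i j)\<^sup>2))
             (\<lambda>k. 0) sequentially"
  shows "(\<lambda>m. mean_under m (pmix m) (\<lambda>z. exp (\<i> * complex_of_real (t * (c m z / \<sigma> m))))
            - (\<Sum>i=1..K. complex_of_real (w i) *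
                 exp (\<i> * complex_of_real (mean_under m (p m i) (c m) / \<sigma> m * t)
                      - complex_of_real (1/2 * (var_under m (p m i) (c m) / (\<sigma> m)\<^sup>2) * t\<^sup>2))))
         \<longlonglongrightarrow> 0"
proof -
  define C where "C i = 3/2 * sqrt 2 * \<bar>t\<bar> ^ 3 / sqrt (w i) ^ 3" for i
  define \<rho> where "\<rho> m i = root 4 (\<Sum>j<h m i. (1 / 4 + (\<delta> m i j)\<^sup>2) * l m i j ^ 4) /
      sqrt (\<Sum>j<h m i. (1 / 2 + (\<delta> m i j)\<^sup>2) * (l m i j)\<^sup>2)" for m i
  define \<phi> where "\<phi> m i = mean_under m (p m i) (\<lambda>z. exp (\<i> * complex_of_real (t * (c m z / \<sigma> m))))" for m i
  define \<psi> where "\<psi> m i = exp (\<i> * complex_of_real (mean_under m (p m i) (c m) / \<sigma> m * t)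
      - complex_of_real (1/2 * (var_under m (p m i) (c m) / (\<sigma> m)\<^sup>2) * t\<^sup>2))" for m i
  have bound: "cmod (mean_under m (pmix m) (\<lambda>z. exp (\<i> * complex_of_real (t * (c m z / \<sigma> m))))
        - (\<Sum>i=1..K. complex_of_real (w i) * \<psi> m i)) \<le> (\<Sum>i=1..K. w i * (C i * (\<rho> m i)\<^sup>2))"
    if m: "m \<ge> 1" for m
  proof -
    \<comment> \<open>A factor of the covariance, not symmetric in general, for which congruence
      turns \<open>A m\<close> into the diagonal matrix. Then \<open>d i\<close> holds the
      coordinates of the mean in this basis.\<close>
    define M where "M i = R m i * D m i" for i
    define d where "d i = transpose_mat (D m i) *\<^sub>v (inv_mat (R m i) *\<^sub>v \<mu> m i)" for i
    define \<beta> where "\<beta> i j = l m i j * d i $ j + (transpose_mat (M i) *\<^sub>v a m) $ j" for i j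
    have A: "A m \<in> carrier_mat m m" and a: "a m \<in> carrier_vec m"
      using assms(9,10) m by auto
    {
      fix i assume i: "i \<in> {1..K}"
      have R: "R m i \<in> carrier_mat m m" "transpose_mat (R m i) = R m i" and R_pd: "pos_def_mat m (R m i)"
        and RR: "R m i * R m i = \<Sigma> m i"
        using assms(13)[OF m i] by (auto simp: pos_def_mat_def)
      have D: "D m i \<in> carrier_mat m m" "transpose_mat (D m i) * D m i = 1\<^sub>m m"
          "D m i * transpose_mat (D m i) = 1\<^sub>m m"
        using assms(14)[OF m i] by (auto simp: orthonormal_mat_def)
      have tD: "transpose_mat (D m i) \<in> carrier_mat m m" using D by simp
      have M: "M i \<in> carrier_mat m m" using R D by (simp add: M_def)
      have tM: "transpose_mat (M i) = transpose_mat (D m i) * R m i"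
        unfolding M_def using transpose_mult[OF R(1) D(1)] R(2) by simp
      have detR: "Determinant.det (R m i) \<noteq> 0"
        by (rule det_pos_def_mat[OF R_pd])
      have "Determinant.det (transpose_mat (D m i)) * Determinant.det (D m i) = 1"
        using det_mult[OF tD D(1)] D(2) by simp
      then have detM: "Determinant.det (M i) \<noteq> 0"
        using detR det_mult[OF R(1) D(1)] by (auto simp: M_def)
      have MM: "M i * transpose_mat (M i) = \<Sigma> m i"
      proof -
        have "M i * transpose_mat (M i) = R m i * (D m i * (transpose_mat (D m i) * R m i))"
          unfolding tM unfolding M_def using R D tD by (intro assoc_mult_mat) auto
        also have "D m i * (transpose_mat (D m i) * R m i) = R m i"
          using assoc_mult_mat[OF D(1) tD R(1)] D(3) R(1) by simp
        finally show ?thesis using RR by simp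
      qed
      have diag: "transpose_mat (M i) * A m * M i = mat_diag m (l m i)"
      proof -
        let ?L = "mat_diag m (l m i)"
        have L: "?L \<in> carrier_mat m m" by simp
        have RAR: "R m i * A m * R m i = D m i * ?L * transpose_mat (D m i)"
          by (rule assms(15)[OF m i])
        have RA: "R m i * A m \<in> carrier_mat m m" using R A by simp
        have "transpose_mat (M i) * A m * M i = transpose_mat (D m i) * ((R m i * A m * R m i) * D m i)"
          unfolding tM unfolding M_def
          by (simp only: assoc_mult_mat[OF tD R(1) A] assoc_mult_mat[OF tD RA mult_carrier_mat[OF R(1) D(1)]]
              assoc_mult_mat[OF RA R(1) D(1)])
        also have "\<dots> = transpose_mat (D m i) * (D m i * ?L * (transpose_mat (D m i) * D m i))"
          unfolding RAR by (simp only: assoc_mult_mat[OF mult_carrier_mat[OF D(1) L] tD D(1)])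
        also have "\<dots> = ?L"
          using assoc_mult_mat[OF tD D(1) L] D(2) L D(1)
          by (simp only: right_mult_one_mat[OF mult_carrier_mat[OF D(1) L]] left_mult_one_mat[OF L])
        finally show ?thesis .
      qed
      have Ri: "inv_mat (R m i) \<in> carrier_mat m m" and RRi: "R m i * inv_mat (R m i) = 1\<^sub>m m"
        using inv_mat[OF R(1) detR] by auto
      have \<mu>: "\<mu> m i \<in> carrier_vec m" by (rule assms(11)[OF m i])
      have Ri\<mu>: "inv_mat (R m i) *\<^sub>v \<mu> m i \<in> carrier_vec m" using Ri \<mu> by simp
      have d: "d i \<in> carrier_vec m" unfolding d_def using tD Ri\<mu> by simp
      have Md: "M i *\<^sub>v d i = \<mu> m i"
      proof -
        have "M i *\<^sub>v d i = R m i *\<^sub>v ((D m i * transpose_mat (D m i)) *\<^sub>v (inv_mat (R m i) *\<^sub>v \<mu> m i))"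
          unfolding M_def assoc_mult_mat_vec[OF R(1) D(1) d] unfolding d_def
          by (simp only: assoc_mult_mat_vec[OF D(1) tD Ri\<mu>])
        also have "\<dots> = (R m i * inv_mat (R m i)) *\<^sub>v \<mu> m i"
          unfolding D(3) one_mult_mat_vec[OF Ri\<mu>] assoc_mult_mat_vec[OF R(1) Ri \<mu>] ..
        finally show ?thesis unfolding RRi one_mult_mat_vec[OF \<mu>] .
      qed
      have p_eq: "p m i = gauss_density m (M i *\<^sub>v d i) (M i * transpose_mat (M i))"
        unfolding p_def Md MM ..
      have \<Sigma>: "\<Sigma> m i \<in> carrier_mat m m" "Determinant.det (\<Sigma> m i) \<noteq> 0"
        using assms(12)[OF m i] det_pos_def_mat by (auto simp: pos_def_mat_def)
      have p_meas: "p m i \<in> borel_measurable (lborel_vec m)"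
        unfolding p_def by (rule borel_measurable_gauss_density[OF \<mu> \<Sigma>])
      have "Determinant.det (\<Sigma> m i) = (Determinant.det (R m i))\<^sup>2"
        unfolding RR[symmetric] det_mult[OF R(1) R(1)] by (simp add: power2_eq_square)
      then have p_nonneg: "p m i z \<ge> 0" for z
        unfolding p_def gauss_density_def by simp
      \<comment> \<open>The restriction to \<open>j < h m i\<close> matters:
        \<open>shift_coeff\<close> divides by the eigenvalue, and only a nonzero one can be
        multiplied back.\<close>
      have \<beta>_\<delta>: "\<beta> i j = l m i j * \<delta> m i j" if j: "j < h m i" for j
      proof -
        have "j < m" using j assms(16)[OF m i] by simp
        then have "l m i j \<noteq> 0" using assms(17)[OF m i] j by blast
        moreover have "transpose_mat (M i) *\<^sub>v a m = transpose_mat (D m i) *\<^sub>v (R m i *\<^sub>v a m)"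
          unfolding tM by (rule assoc_mult_mat_vec[OF tD R(1) a])
        ultimately show ?thesis
          unfolding \<beta>_def \<delta>_def shift_coeff_def d_def by (simp only: distrib_left nonzero_mult_div_cancel_left times_divide_eq_right simp_thms)
      qed
      note quad = prob_space_law_gauss[OF M detM A diag a d, folded p_eq]
        integrable_quad_gauss[OF M detM A diag a d, folded p_eq, of "a0 m"]
        integrable_quad_square_gauss[OF M detM A diag a d, folded p_eq, of "a0 m"]
        var_quad_gauss[OF M detM A diag a d, folded p_eq \<beta>_def, of "a0 m"]
        char_quad_gauss_bound[OF M detM A diag a d, folded p_eq \<beta>_def, of "t / \<sigma> m" "a0 m"]
      note p_meas p_nonneg \<beta>_\<delta> quad[folded fun_cong[OF c_def[THEN meta_eq_to_obj_eq]]]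
    } note comp = this
    have c_meas: "c m \<in> borel_measurable (lborel_vec m)"
      unfolding c_def by (rule borel_measurable_quad[OF A a])
    \<comment> \<open>Kept polymorphic in the value type: it serves the real variance and the
      complex characteristic function.\<close>
    have mix: "mean_under m (pmix m) f = (\<Sum>i=1..K. w i *\<^sub>R mean_under m (p m i) f)"
      if "f \<in> borel_measurable (lborel_vec m)" "\<And>i. i \<in> {1..K} \<Longrightarrow> integrable (law m (p m i)) f"
      for f :: "real vec \<Rightarrow> 'b::{banach, second_countable_topology}"
      unfolding pmix_def p_def
      by (rule mean_under_mixture) (use that comp(1,2) assms(7) in \<open>auto simp: p_def less_imp_le\<close>)
    have w0: "w i > 0" if "i \<in> {1..K}" for i by (rule assms(7)[OF that])
    have int_sq: "integrable (law m (p m i)) (\<lambda>z. (c m z - x)\<^sup>2)" if i: "i \<in> {1..K}" for i x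
    proof -
      interpret prob_space "law m (p m i)" by (rule comp(4)[OF i])
      have "integrable (law m (p m i)) (\<lambda>z. (c m z)\<^sup>2 + (- 2 * x) * c m z + x\<^sup>2)"
        using comp(5,6)[OF i] by (intro Bochner_Integration.integrable_add integrable_mult_right) auto
      then show ?thesis by (simp add: power2_diff algebra_simps)
    qed
    define V where "V i = var_under m (p m i) (c m)" for i
    define E where "E = mean_under m (pmix m) (c m)"
    have V0: "0 \<le> V i" if "i \<in> {1..K}" for i
      unfolding V_def comp(7)[OF that] by (intro sum_nonneg) auto
    \<comment> \<open>The within-component half of the law of total variance: it bounds the mixture
      variance from below by the contribution of each single component.\<close>
    have var: "w i * V i \<le> var_under m (pmix m) (c m)" if i: "i \<in> {1..K}" for i
    proof -
      have "w i * V i \<le> (\<Sum>k=1..K. w k * V k)"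
        using i w0 V0 by (intro member_le_sum) (auto simp: less_imp_le)
      also have "\<dots> \<le> (\<Sum>k=1..K. w k *\<^sub>R mean_under m (p m k) (\<lambda>z. (c m z - E)\<^sup>2))"
        unfolding V_def real_scaleR_def using w0
        by (intro sum_mono mult_left_mono var_under_le comp(4,5,6)) (auto simp: less_imp_le)
      also have "\<dots> = var_under m (pmix m) (c m)"
        unfolding var_under_def E_def[symmetric]
        by (rule mix[symmetric]) (use c_meas int_sq in auto)
      finally show ?thesis .
    qed
    \<comment> \<open>Any component shows that the mixture variance is nonnegative, so that squaring
      \<open>\<sigma> m\<close> gives it back.\<close>
    obtain i0 where i0: "i0 \<in> {1..K}" using \<open>K \<ge> 1\<close> by auto
    have var_nonneg: "var_under m (pmix m) (c m) \<ge> 0"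
      using var[OF i0] w0[OF i0] V0[OF i0] by (meson less_imp_le mult_nonneg_nonneg order_trans)
    have \<sigma>2: "(\<sigma> m)\<^sup>2 = var_under m (pmix m) (c m)" "\<sigma> m \<ge> 0"
      using var_nonneg by (auto simp: \<sigma>_def)
    have one: "cmod (\<phi> m i - \<psi> m i) \<le> C i * (\<rho> m i)\<^sup>2" if i: "i \<in> {1..K}" for i
    proof -
      have "\<phi> m i = mean_under m (p m i) (\<lambda>z. iexp (t / \<sigma> m * c m z))"
        unfolding \<phi>_def by simp
      moreover have "\<psi> m i = exp (\<i> * complex_of_real (t / \<sigma> m * mean_under m (p m i) (c m))
          - complex_of_real ((t / \<sigma> m)\<^sup>2 * var_under m (p m i) (c m) / 2))"
        unfolding \<psi>_def by (simp add: power_divide mult_ac)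
      ultimately have "cmod (\<phi> m i - \<psi> m i)
          \<le> 3/2 * \<bar>t / \<sigma> m\<bar> ^ 3 * (\<Sum>j<m. \<bar>l m i j\<bar> * ((l m i j)\<^sup>2 / 2 + (\<beta> i j)\<^sup>2))"
        using comp(8)[OF i] by simp
      also have "\<dots> \<le> C i * (\<rho> m i)\<^sup>2"
        unfolding C_def \<rho>_def
        by (rule quadratic_error_le_fourth_order_ratio[OF _ _ assms(17)[OF m i] comp(3)[OF i] w0[OF i]])
           (use assms(16)[OF m i] var[OF i] \<sigma>2 comp(7)[OF i] in \<open>auto simp: V_def\<close>)
      finally show ?thesis .
    qed
    have "mean_under m (pmix m) (\<lambda>z. exp (\<i> * complex_of_real (t * (c m z / \<sigma> m)))) = (\<Sum>i=1..K. w i *\<^sub>R \<phi> m i)"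
      unfolding \<phi>_def
    proof (rule mix)
      show 1: "(\<lambda>z. exp (\<i> * complex_of_real (t * (c m z / \<sigma> m)))) \<in> borel_measurable (lborel_vec m)"
        using c_meas by measurable
      fix i assume i: "i \<in> {1..K}"
      interpret prob_space "law m (p m i)" by (rule comp(4)[OF i])
      show "integrable (law m (p m i)) (\<lambda>z. exp (\<i> * complex_of_real (t * (c m z / \<sigma> m))))"
        by (rule integrable_const_bound[where B=1]) (use 1 in \<open>auto simp: law_def\<close>)
    qed
    then have "mean_under m (pmix m) (\<lambda>z. exp (\<i> * complex_of_real (t * (c m z / \<sigma> m))))
        - (\<Sum>i=1..K. complex_of_real (w i) * \<psi> m i) = (\<Sum>i=1..K. w i *\<^sub>R (\<phi> m i - \<psi> m i))"
      by (simp add: scaleR_conv_of_real sum_subtractf right_diff_distrib)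
    also have "cmod \<dots> \<le> (\<Sum>i=1..K. cmod (w i *\<^sub>R (\<phi> m i - \<psi> m i)))"
      by (rule norm_sum)
    also have "\<dots> \<le> (\<Sum>i=1..K. w i * (C i * (\<rho> m i)\<^sup>2))"
      using one w0 by (intro sum_mono) (auto simp: less_imp_le intro!: mult_left_mono)
    finally show ?thesis .
  qed
  have "(\<lambda>m. \<rho> m i) \<longlonglongrightarrow> 0" if i: "i \<in> {1..K}" for i
    using tendsto_uniform_limitI[OF assms(19)[OF i], of 4] by (simp add: \<rho>_def)
  then have "(\<lambda>m. \<Sum>i=1..K. w i * (C i * (\<rho> m i)\<^sup>2)) \<longlonglongrightarrow> (\<Sum>i=1..K. w i * (C i * 0\<^sup>2))"
    by (intro tendsto_sum tendsto_mult tendsto_power tendsto_const)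
  then have "(\<lambda>m. \<Sum>i=1..K. w i * (C i * (\<rho> m i)\<^sup>2)) \<longlonglongrightarrow> 0" by simp
  \<comment> \<open>The estimate is available for \<open>m \<ge> 1\<close>, hence
    eventually.\<close>
  then show ?thesis
    unfolding \<psi>_def[symmetric]
    by (rule Lim_null_comparison[rotated]) (use bound in \<open>auto intro: eventually_sequentiallyI\<close>)
qed

end
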